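(* Let $n>3$ and let $G_1$ be a non-abelian group of order $2^n$ having a cyclic subgroup of order $2^{n-1}$. Then $G_1$ cannot be constructed via a corestriction homomorphism; that is, for every group extension $$1\longrightarrow \mu_2\longrightarrow G_1\longrightarrow G\longrightarrow 1$$ with class $c\in H^2(G,\mu_2)$, there do not exist a subgroup $H<G$ of index $2$ and a class $\bar c\in H^2(H,\mu_2)$ such that $c=\mathrm{cor}_{G/H}(\bar c)$.
   Context: $\mu_2=\{\pm1\}$ is regarded as a trivial module. $\mathrm{cor}_{G/H}:H^2(H,\mu_2)\to H^2(G,\mu_2)$ is the usual corestriction (transfer) homomorphism in group cohomology. For $n>3$ the non-abelian groups of order $2^n$ with a cyclic subgroup of order $2^{n-1}$ are, up to isomorphism, exactly the four groups generated by $\sigma,\tau$ with the following relations: the dihedral group $D_{2^n}$: $\sigma^{2^{n-1}}=\tau^2=1$, $\tau\sigma=\sigma^{-1}\tau$; the semidihedral group $SD_{2^n}$: $\sigma^{2^{n-1}}=\tau^2=1$, $\tau\sigma=\sigma^{2^{n-2}-1}\tau$; the quaternion group $Q_{2^n}$: $\sigma^{2^{n-1}}=1$, $\tau^2=\sigma^{2^{n-2}}$, $\tau\sigma=\sigma^{-1}\tau$; the modular group $M_{2^n}$: $\sigma^{2^{n-1}}=\tau^2=1$, $\tau\sigma=\sigma^{2^{n-2}+1}\tau$. In each of them the only central subgroup of order $2$ is $\langle\sigma^{2^{n-2}}\rangle$, so the kernel of any extension as in the claim is this subgroup. *)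

theory Defs
  imports "HOL-Algebra.Product_Groups" "HOL-Algebra.FiniteProduct"
begin

section \<open>Second cohomology with trivial coefficients\<close>

text \<open>Inhomogeneous cochains. The coefficient group \<open>A\<close> is abelian, written multiplicatively,
  and \<open>G\<close> acts trivially on it.\<close>

definition C1 :: "('g, 'm) monoid_scheme \<Rightarrow> ('a, 'k) monoid_scheme \<Rightarrow> ('g \<Rightarrow> 'a) monoid" where
  "C1 G A = product_group (carrier G) (\<lambda>_. A)"

definition C2 :: "('g, 'm) monoid_scheme \<Rightarrow> ('a, 'k) monoid_scheme \<Rightarrow> ('g \<times> 'g \<Rightarrow> 'a) monoid" where
  "C2 G A = product_group (carrier G \<times> carrier G) (\<lambda>_. A)"

definition Z2 :: "('g, 'm) monoid_scheme \<Rightarrow> ('a, 'k) monoid_scheme \<Rightarrow> ('g \<times> 'g \<Rightarrow> 'a) set" where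
  "Z2 G A = {f \<in> carrier (C2 G A). \<forall>g\<in>carrier G. \<forall>h\<in>carrier G. \<forall>k\<in>carrier G.
     f (h, k) \<otimes>\<^bsub>A\<^esub> f (g, h \<otimes>\<^bsub>G\<^esub> k) = f (g \<otimes>\<^bsub>G\<^esub> h, k) \<otimes>\<^bsub>A\<^esub> f (g, h)}"

definition d1 :: "('g, 'm) monoid_scheme \<Rightarrow> ('a, 'k) monoid_scheme \<Rightarrow> ('g \<Rightarrow> 'a) \<Rightarrow> 'g \<times> 'g \<Rightarrow> 'a" where
  "d1 G A b = (\<lambda>(g, h)\<in>carrier G \<times> carrier G. b g \<otimes>\<^bsub>A\<^esub> b h \<otimes>\<^bsub>A\<^esub> inv\<^bsub>A\<^esub> (b (g \<otimes>\<^bsub>G\<^esub> h)))"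

definition B2 :: "('g, 'm) monoid_scheme \<Rightarrow> ('a, 'k) monoid_scheme \<Rightarrow> ('g \<times> 'g \<Rightarrow> 'a) set" where
  "B2 G A = d1 G A ` carrier (C1 G A)"

definition H2 :: "('g, 'm) monoid_scheme \<Rightarrow> ('a, 'k) monoid_scheme \<Rightarrow> ('g \<times> 'g \<Rightarrow> 'a) set monoid" where
  "H2 G A = (C2 G A)\<lparr>carrier := Z2 G A\<rparr> Mod B2 G A"

definition mu2 :: "int monoid" where
  "mu2 = \<lparr>carrier = {1, -1}, monoid.mult = (*), one = 1\<rparr>"


section \<open>Extensions and their classes\<close>

definition group_extension ::
  "('a, 'k) monoid_scheme \<Rightarrow> ('a \<Rightarrow> 'e) \<Rightarrow> ('e, 'l) monoid_scheme \<Rightarrow> ('e \<Rightarrow> 'g) \<Rightarrow> ('g, 'm) monoid_scheme \<Rightarrow> bool"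
  where "group_extension A i E p G \<longleftrightarrow>
    group A \<and> group E \<and> group G \<and> i \<in> mon A E \<and> p \<in> epi E G \<and> i ` carrier A = kernel E G p"

text \<open>The class of an extension with central kernel: the set of the factor sets of all its
  set-theoretic sections. This set is a full coset of \<open>B2 G A\<close>, see \<open>extension_class_in_H2\<close>.\<close>

definition extension_class ::
  "('a, 'k) monoid_scheme \<Rightarrow> ('a \<Rightarrow> 'e) \<Rightarrow> ('e, 'l) monoid_scheme \<Rightarrow> ('e \<Rightarrow> 'g) \<Rightarrow> ('g, 'm) monoid_scheme
    \<Rightarrow> ('g \<times> 'g \<Rightarrow> 'a) set" where
  "extension_class A i E p G = {f \<in> carrier (C2 G A).
     \<exists>s \<in> carrier G \<rightarrow> carrier E. (\<forall>g\<in>carrier G. p (s g) = g) \<and>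
       (\<forall>g\<in>carrier G. \<forall>h\<in>carrier G. s g \<otimes>\<^bsub>E\<^esub> s h = i (f (g, h)) \<otimes>\<^bsub>E\<^esub> s (g \<otimes>\<^bsub>G\<^esub> h))}"


section \<open>Corestriction\<close>

text \<open>A transversal \<open>s\<close> picks an element of every right coset \<open>U\<close> of \<open>H\<close>. For homogeneous cochains the
  corestriction is \<open>(cor x)(g0,g1,g2) = \<Prod>U. x (s U g0 s(U g0)^{-1}, s U g1 s(U g1)^{-1}, s U g2 s(U g2)^{-1})\<close>;
  \<open>cor_cochain\<close> is its inhomogeneous form.\<close>

definition transversals :: "('g, 'm) monoid_scheme \<Rightarrow> 'g set \<Rightarrow> ('g set \<Rightarrow> 'g) set" where
  "transversals G H = (\<Pi> U\<in>rcosets\<^bsub>G\<^esub> H. U)"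

definition transfer_elt :: "('g, 'm) monoid_scheme \<Rightarrow> ('g set \<Rightarrow> 'g) \<Rightarrow> 'g set \<Rightarrow> 'g \<Rightarrow> 'g" where
  "transfer_elt G s U g = s U \<otimes>\<^bsub>G\<^esub> g \<otimes>\<^bsub>G\<^esub> inv\<^bsub>G\<^esub> (s (U #>\<^bsub>G\<^esub> g))"

definition cor_cochain ::
  "('g, 'm) monoid_scheme \<Rightarrow> 'g set \<Rightarrow> ('a, 'k) monoid_scheme \<Rightarrow> ('g set \<Rightarrow> 'g) \<Rightarrow> ('g \<times> 'g \<Rightarrow> 'a) \<Rightarrow> 'g \<times> 'g \<Rightarrow> 'a"
  where "cor_cochain G H A s f = (\<lambda>(g, h)\<in>carrier G \<times> carrier G.
    \<Otimes>\<^bsub>A\<^esub>U\<in>(rcosets\<^bsub>G\<^esub> H). f (transfer_elt G s U g, transfer_elt G s (U #>\<^bsub>G\<^esub> g) h))"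

text \<open>For \<open>H\<close> of finite index. All the cosets joined here are equal, see \<open>corestriction_coset\<close>, and the
  resulting map is a homomorphism, see \<open>corestriction_hom\<close>.\<close>

definition corestriction ::
  "('g, 'm) monoid_scheme \<Rightarrow> 'g set \<Rightarrow> ('a, 'k) monoid_scheme \<Rightarrow> ('g \<times> 'g \<Rightarrow> 'a) set \<Rightarrow> ('g \<times> 'g \<Rightarrow> 'a) set"
  where "corestriction G H A c =
    (\<Union>s\<in>transversals G H. \<Union>f\<in>c. B2 G A #>\<^bsub>C2 G A\<^esub> cor_cochain G H A s f)"


section \<open>The definitions are meaningful\<close>

lemma mu2_comm_group: "comm_group mu2"
proof -
  have "group mu2" by (rule groupI) (auto simp: mu2_def)
  then show ?thesis
    by (rule group.group_comm_groupI) (auto simp: mu2_def)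
qed

lemma (in comm_group) comm_group_C2: "comm_group (C2 K G)"
proof -
  have "group (C2 K G)" by (simp add: C2_def)
  then show ?thesis
    by (rule group.group_comm_groupI) (auto simp: C2_def PiE_iff m_comm intro!: restrict_ext)
qed

lemma (in comm_group) exchange4:
  assumes "a \<in> carrier G" "b \<in> carrier G" "c \<in> carrier G" "d \<in> carrier G"
  shows "(a \<otimes> b) \<otimes> (c \<otimes> d) = (a \<otimes> c) \<otimes> (b \<otimes> d)"
  using assms by (simp add: m_ac)

lemma (in comm_group) inv_cancel_mid:
  assumes "x \<in> carrier G" "y \<in> carrier G"
  shows "x \<otimes> (inv x \<otimes> y) = y" "inv x \<otimes> (x \<otimes> y) = y"
  using assms by (simp_all flip: m_assoc)

locale trivial_module = group G + A: comm_group A for G (structure) and A (structure)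
begin

lemma comm_group_C2 [simp]: "comm_group (C2 G A)"
  by (rule A.comm_group_C2)

lemma group_C2 [simp]: "group (C2 G A)"
  using comm_group_C2 comm_group.axioms(2) by blast

lemma C1D: "b \<in> carrier (C1 G A) \<Longrightarrow> g \<in> carrier G \<Longrightarrow> b g \<in> carrier A"
  by (auto simp: C1_def PiE_iff)

lemma C2D: "f \<in> carrier (C2 G A) \<Longrightarrow> g \<in> carrier G \<Longrightarrow> h \<in> carrier G \<Longrightarrow> f (g, h) \<in> carrier A"
  by (auto simp: C2_def PiE_iff)

lemma Z2_C2: "f \<in> Z2 G A \<Longrightarrow> f \<in> carrier (C2 G A)"
  by (simp add: Z2_def)

lemma Z2D: "f \<in> Z2 G A \<Longrightarrow> g \<in> carrier G \<Longrightarrow> h \<in> carrier G \<Longrightarrow> f (g, h) \<in> carrier A"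
  by (simp add: Z2_def C2D)

lemma Z2_eq: "f \<in> Z2 G A \<Longrightarrow> g \<in> carrier G \<Longrightarrow> h \<in> carrier G \<Longrightarrow> k \<in> carrier G \<Longrightarrow>
    f (h, k) \<otimes>\<^bsub>A\<^esub> f (g, h \<otimes> k) = f (g \<otimes> h, k) \<otimes>\<^bsub>A\<^esub> f (g, h)"
  by (simp add: Z2_def)

lemma C2_mult_apply: "g \<in> carrier G \<Longrightarrow> h \<in> carrier G \<Longrightarrow>
    (e \<otimes>\<^bsub>C2 G A\<^esub> f) (g, h) = e (g, h) \<otimes>\<^bsub>A\<^esub> f (g, h)"
  by (simp add: C2_def)

lemma C2_eqI:
  assumes "e \<in> carrier (C2 G A)" "f \<in> carrier (C2 G A)"
    and "\<And>g h. g \<in> carrier G \<Longrightarrow> h \<in> carrier G \<Longrightarrow> e (g, h) = f (g, h)"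
  shows "e = f"
  using assms unfolding C2_def carrier_product_group by (intro PiE_ext) auto

lemma subgroup_Z2: "subgroup (Z2 G A) (C2 G A)"
proof (rule group.subgroupI)
  have "(\<lambda>_\<in>carrier G \<times> carrier G. \<one>\<^bsub>A\<^esub>) \<in> Z2 G A"
    by (auto simp: Z2_def C2_def)
  then show "Z2 G A \<noteq> {}" by auto
  fix f assume f: "f \<in> Z2 G A"
  have i: "inv\<^bsub>C2 G A\<^esub> f = (\<lambda>x\<in>carrier G \<times> carrier G. inv\<^bsub>A\<^esub> f x)"
    using Z2_C2[OF f] unfolding C2_def by simp
  have c: "inv\<^bsub>C2 G A\<^esub> f \<in> carrier (C2 G A)"
    using Z2_C2[OF f] by (simp add: group.inv_closed)
  show "inv\<^bsub>C2 G A\<^esub> f \<in> Z2 G A"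
    using c Z2_eq[OF f] Z2D[OF f] unfolding Z2_def i
    by (simp flip: A.inv_mult)
next
  fix e f assume e: "e \<in> Z2 G A" and f: "f \<in> Z2 G A"
  have c: "e \<otimes>\<^bsub>C2 G A\<^esub> f \<in> carrier (C2 G A)"
    using Z2_C2[OF e] Z2_C2[OF f] monoid.m_closed[OF group.is_monoid[OF group_C2]] by blast
  have "(e \<otimes>\<^bsub>C2 G A\<^esub> f) (h, k) \<otimes>\<^bsub>A\<^esub> (e \<otimes>\<^bsub>C2 G A\<^esub> f) (g, h \<otimes> k)
      = (e \<otimes>\<^bsub>C2 G A\<^esub> f) (g \<otimes> h, k) \<otimes>\<^bsub>A\<^esub> (e \<otimes>\<^bsub>C2 G A\<^esub> f) (g, h)"
    if "g \<in> carrier G" "h \<in> carrier G" "k \<in> carrier G" for g h k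
    using that
    using A.exchange4[of "e (h, k)" "f (h, k)" "e (g, h \<otimes> k)" "f (g, h \<otimes> k)"]
      A.exchange4[of "e (g \<otimes> h, k)" "f (g \<otimes> h, k)" "e (g, h)" "f (g, h)"]
    by (simp add: C2_mult_apply Z2D[OF e] Z2D[OF f] Z2_eq[OF e] Z2_eq[OF f])
  with c show "e \<otimes>\<^bsub>C2 G A\<^esub> f \<in> Z2 G A"
    by (simp add: Z2_def)
qed (auto simp: Z2_def)

lemma d1_apply: "g \<in> carrier G \<Longrightarrow> h \<in> carrier G \<Longrightarrow>
    d1 G A b (g, h) = b g \<otimes>\<^bsub>A\<^esub> b h \<otimes>\<^bsub>A\<^esub> inv\<^bsub>A\<^esub> (b (g \<otimes> h))"
  by (simp add: d1_def)

lemma d1_C2: "b \<in> carrier (C1 G A) \<Longrightarrow> d1 G A b \<in> carrier (C2 G A)"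
  by (auto simp: d1_def C2_def C1D)

lemma d1_Z2:
  assumes "b \<in> carrier (C1 G A)" shows "d1 G A b \<in> Z2 G A"
  using d1_C2[OF assms]
  by (auto simp: Z2_def d1_apply C1D[OF assms] m_assoc A.m_ac A.inv_cancel_mid)

lemma B2_Z2: "B2 G A \<subseteq> Z2 G A"
  using d1_Z2 by (auto simp: B2_def)

lemma d1_hom: "d1 G A \<in> hom (C1 G A) (C2 G A)"
proof (rule homI)
  fix b c assume b: "b \<in> carrier (C1 G A)" and c: "c \<in> carrier (C1 G A)"
  have bc: "b \<otimes>\<^bsub>C1 G A\<^esub> c \<in> carrier (C1 G A)"
    using b c by (auto simp: C1_def PiE_iff)
  have ap: "(b \<otimes>\<^bsub>C1 G A\<^esub> c) g = b g \<otimes>\<^bsub>A\<^esub> c g" if "g \<in> carrier G" for g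
    using that by (simp add: C1_def)
  show "d1 G A (b \<otimes>\<^bsub>C1 G A\<^esub> c) = d1 G A b \<otimes>\<^bsub>C2 G A\<^esub> d1 G A c"
  proof (rule C2_eqI)
    show "d1 G A b \<otimes>\<^bsub>C2 G A\<^esub> d1 G A c \<in> carrier (C2 G A)"
      using d1_C2[OF b] d1_C2[OF c] monoid.m_closed[OF group.is_monoid[OF group_C2]] by blast
  qed (auto simp: d1_C2 bc d1_apply C2_mult_apply ap C1D[OF b] C1D[OF c] A.inv_mult A.m_ac)
qed (rule d1_C2)

lemma subgroup_B2: "subgroup (B2 G A) (C2 G A)"
proof -
  have "group (C1 G A)" by (simp add: C1_def)
  then interpret d: group_hom "C1 G A" "C2 G A" "d1 G A"
    using d1_hom by (simp add: group_hom_def group_hom_axioms_def)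
  show ?thesis unfolding B2_def by (rule d.img_is_subgroup)
qed

lemma comm_group_Z2: "comm_group ((C2 G A)\<lparr>carrier := Z2 G A\<rparr>)"
proof -
  interpret C: comm_group "C2 G A" by simp
  show ?thesis
    by (rule group.group_comm_groupI)
       (auto simp: C.subgroup_imp_group[OF subgroup_Z2] intro: C.m_comm Z2_C2)
qed

lemma normal_B2: "B2 G A \<lhd> (C2 G A)\<lparr>carrier := Z2 G A\<rparr>"
  using comm_group.subgroup_imp_normal[OF comm_group_Z2]
    group.subgroup_incl[OF group_C2 subgroup_B2 subgroup_Z2 B2_Z2] by blast

theorem H2_comm_group: "comm_group (H2 G A)"
  unfolding H2_def
  using comm_group.abelian_FactGroup[OF comm_group_Z2]
    group.subgroup_incl[OF group_C2 subgroup_B2 subgroup_Z2 B2_Z2] by blast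

lemma carrier_H2: "carrier (H2 G A) = (\<lambda>f. B2 G A #>\<^bsub>C2 G A\<^esub> f) ` Z2 G A"
  by (simp add: H2_def carrier_FactGroup)

lemma H2_mult:
  assumes "e \<in> Z2 G A" "f \<in> Z2 G A"
  shows "(B2 G A #>\<^bsub>C2 G A\<^esub> e) \<otimes>\<^bsub>H2 G A\<^esub> (B2 G A #>\<^bsub>C2 G A\<^esub> f)
       = B2 G A #>\<^bsub>C2 G A\<^esub> (e \<otimes>\<^bsub>C2 G A\<^esub> f)"
  using normal.rcos_sum[OF normal_B2, of e f] assms by (simp add: H2_def)

lemma mem_coset_iff:
  assumes e: "e \<in> carrier (C2 G A)" and f: "f \<in> carrier (C2 G A)"
  shows "e \<in> B2 G A #>\<^bsub>C2 G A\<^esub> f \<longleftrightarrow> (\<exists>b \<in> carrier G \<rightarrow> carrier A. \<forall>g\<in>carrier G. \<forall>h\<in>carrier G.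
     e (g, h) \<otimes>\<^bsub>A\<^esub> b (g \<otimes> h) = f (g, h) \<otimes>\<^bsub>A\<^esub> (b g \<otimes>\<^bsub>A\<^esub> b h))"
proof
  assume "e \<in> B2 G A #>\<^bsub>C2 G A\<^esub> f"
  then obtain b where b: "b \<in> carrier (C1 G A)" and e': "e = d1 G A b \<otimes>\<^bsub>C2 G A\<^esub> f"
    by (auto simp: r_coset_def B2_def)
  show "\<exists>b \<in> carrier G \<rightarrow> carrier A. \<forall>g\<in>carrier G. \<forall>h\<in>carrier G.
     e (g, h) \<otimes>\<^bsub>A\<^esub> b (g \<otimes> h) = f (g, h) \<otimes>\<^bsub>A\<^esub> (b g \<otimes>\<^bsub>A\<^esub> b h)"
    by (rule bexI[of _ b])
       (auto simp: e' C2_mult_apply d1_apply C1D[OF b] C2D[OF f] A.m_ac A.inv_cancel_mid)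
next
  assume "\<exists>b \<in> carrier G \<rightarrow> carrier A. \<forall>g\<in>carrier G. \<forall>h\<in>carrier G.
     e (g, h) \<otimes>\<^bsub>A\<^esub> b (g \<otimes> h) = f (g, h) \<otimes>\<^bsub>A\<^esub> (b g \<otimes>\<^bsub>A\<^esub> b h)"
  then obtain b where b: "b \<in> carrier G \<rightarrow> carrier A"
    and eq: "\<And>g h. g \<in> carrier G \<Longrightarrow> h \<in> carrier G \<Longrightarrow>
      e (g, h) \<otimes>\<^bsub>A\<^esub> b (g \<otimes> h) = f (g, h) \<otimes>\<^bsub>A\<^esub> (b g \<otimes>\<^bsub>A\<^esub> b h)" by blast
  let ?b = "restrict b (carrier G)"
  have b': "?b \<in> carrier (C1 G A)" using b by (auto simp: C1_def)
  have bD: "b g \<in> carrier A" if "g \<in> carrier G" for g using b that by blast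
  have "e = d1 G A ?b \<otimes>\<^bsub>C2 G A\<^esub> f"
  proof (rule C2_eqI[OF e])
    show "d1 G A ?b \<otimes>\<^bsub>C2 G A\<^esub> f \<in> carrier (C2 G A)"
      using d1_C2[OF b'] f monoid.m_closed[OF group.is_monoid[OF group_C2]] by blast
    fix g h assume gh: "g \<in> carrier G" "h \<in> carrier G"
    have "e (g, h) = (e (g, h) \<otimes>\<^bsub>A\<^esub> b (g \<otimes> h)) \<otimes>\<^bsub>A\<^esub> inv\<^bsub>A\<^esub> b (g \<otimes> h)"
      using gh by (simp add: bD C2D[OF e] A.m_assoc)
    then show "e (g, h) = (d1 G A ?b \<otimes>\<^bsub>C2 G A\<^esub> f) (g, h)"
      using gh by (simp add: eq C2_mult_apply d1_apply bD C2D[OF f] A.m_ac)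
  qed
  then show "e \<in> B2 G A #>\<^bsub>C2 G A\<^esub> f"
    using b' by (auto simp: r_coset_def B2_def)
qed

lemma coset_eqI:
  assumes "f \<in> carrier (C2 G A)" "e \<in> B2 G A #>\<^bsub>C2 G A\<^esub> f"
  shows "B2 G A #>\<^bsub>C2 G A\<^esub> e = B2 G A #>\<^bsub>C2 G A\<^esub> f"
  using group.repr_independence[OF group_C2 assms(2,1) subgroup_B2] by simp

lemma coset_self: "f \<in> carrier (C2 G A) \<Longrightarrow> f \<in> B2 G A #>\<^bsub>C2 G A\<^esub> f"
  using group.rcos_self[OF group_C2 _ subgroup_B2] by blast

theorem extension_class_in_H2:
  assumes ext: "group_extension A i E p G"
    and central: "\<And>a e. a \<in> carrier A \<Longrightarrow> e \<in> carrier E \<Longrightarrow> i a \<otimes>\<^bsub>E\<^esub> e = e \<otimes>\<^bsub>E\<^esub> i a"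
  shows "extension_class A i E p G \<in> carrier (H2 G A)"
proof -
  interpret E: group E using ext by (simp add: group_extension_def)
  have i: "i \<in> hom A E" and inj: "inj_on i (carrier A)"
    and p: "p \<in> hom E G" and surj: "p ` carrier E = carrier G"
    and ker: "i ` carrier A = kernel E G p"
    using ext by (auto simp: group_extension_def mon_def epi_def)
  interpret i: group_hom A E i by unfold_locales (rule i)
  interpret p: group_hom E G p by unfold_locales (rule p)
  have fibre: "\<exists>a\<in>carrier A. x = i a \<otimes>\<^bsub>E\<^esub> y"
    if "x \<in> carrier E" "y \<in> carrier E" "p x = p y" for x y
  proof -
    have "x \<otimes>\<^bsub>E\<^esub> inv\<^bsub>E\<^esub> y \<in> kernel E G p" using that by (simp add: kernel_def)
    then obtain a where "a \<in> carrier A" "x \<otimes>\<^bsub>E\<^esub> inv\<^bsub>E\<^esub> y = i a" using ker by blast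
    then show ?thesis using that by (metis E.inv_solve_right' i.hom_closed)
  qed
  have p_i: "p (i a) = \<one>" if "a \<in> carrier A" for a
    using ker that by (auto simp: kernel_def)
  define fs where "fs s f \<longleftrightarrow> (\<forall>g\<in>carrier G. \<forall>h\<in>carrier G. s g \<otimes>\<^bsub>E\<^esub> s h = i (f (g, h)) \<otimes>\<^bsub>E\<^esub> s (g \<otimes> h))"
    for s f
  define sec where "sec s \<longleftrightarrow> s \<in> carrier G \<rightarrow> carrier E \<and> (\<forall>g\<in>carrier G. p (s g) = g)" for s
  have cls: "extension_class A i E p G = {f \<in> carrier (C2 G A). \<exists>s. sec s \<and> fs s f}"
    by (auto simp: extension_class_def sec_def fs_def)
  have secD: "s g \<in> carrier E" "p (s g) = g" if "sec s" "g \<in> carrier G" for s g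
    using that by (auto simp: sec_def)
  obtain s where s: "sec s"
  proof
    show "sec (inv_into (carrier E) p)"
      using surj by (auto simp: sec_def inv_into_into f_inv_into_f)
  qed
  have "\<exists>a\<in>carrier A. s g \<otimes>\<^bsub>E\<^esub> s h = i a \<otimes>\<^bsub>E\<^esub> s (g \<otimes> h)" if "g \<in> carrier G" "h \<in> carrier G" for g h
    using that by (intro fibre) (simp_all add: secD[OF s])
  then obtain f0 where f0: "\<And>g h. g \<in> carrier G \<Longrightarrow> h \<in> carrier G \<Longrightarrow>
      f0 g h \<in> carrier A \<and> s g \<otimes>\<^bsub>E\<^esub> s h = i (f0 g h) \<otimes>\<^bsub>E\<^esub> s (g \<otimes> h)"
    by metis
  define f where "f = (\<lambda>(g, h)\<in>carrier G \<times> carrier G. f0 g h)"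
  have f: "f \<in> carrier (C2 G A)" using f0 by (auto simp: f_def C2_def)
  have fsf: "fs s f" using f0 by (simp add: fs_def f_def)
  have fsD: "s g \<otimes>\<^bsub>E\<^esub> s h = i (f (g, h)) \<otimes>\<^bsub>E\<^esub> s (g \<otimes> h)"
    if "fs s f" "g \<in> carrier G" "h \<in> carrier G" for s f g h using that by (simp add: fs_def)
  have "f (h, k) \<otimes>\<^bsub>A\<^esub> f (g, h \<otimes> k) = f (g \<otimes> h, k) \<otimes>\<^bsub>A\<^esub> f (g, h)"
    if g: "g \<in> carrier G" and h: "h \<in> carrier G" and k: "k \<in> carrier G" for g h k
  proof -
    note cl = g h k secD[OF s] C2D[OF f]
    have "i (f (h, k) \<otimes>\<^bsub>A\<^esub> f (g, h \<otimes> k)) \<otimes>\<^bsub>E\<^esub> s (g \<otimes> h \<otimes> k)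
        = i (f (h, k)) \<otimes>\<^bsub>E\<^esub> (s g \<otimes>\<^bsub>E\<^esub> s (h \<otimes> k))"
      using cl fsD[OF fsf g, of "h \<otimes> k"] by (simp add: E.m_assoc m_assoc)
    also have "\<dots> = s g \<otimes>\<^bsub>E\<^esub> (i (f (h, k)) \<otimes>\<^bsub>E\<^esub> s (h \<otimes> k))"
      using cl central[of "f (h, k)" "s g"] by (simp flip: E.m_assoc)
    also have "\<dots> = (s g \<otimes>\<^bsub>E\<^esub> s h) \<otimes>\<^bsub>E\<^esub> s k"
      using cl fsD[OF fsf h k] by (simp add: E.m_assoc)
    also have "\<dots> = i (f (g, h)) \<otimes>\<^bsub>E\<^esub> (s (g \<otimes> h) \<otimes>\<^bsub>E\<^esub> s k)"
      using cl fsD[OF fsf g h] by (simp add: E.m_assoc)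
    also have "\<dots> = i (f (g, h) \<otimes>\<^bsub>A\<^esub> f (g \<otimes> h, k)) \<otimes>\<^bsub>E\<^esub> s (g \<otimes> h \<otimes> k)"
      using cl fsD[OF fsf _ k, of "g \<otimes> h"] by (simp add: E.m_assoc)
    finally have "i (f (h, k) \<otimes>\<^bsub>A\<^esub> f (g, h \<otimes> k)) = i (f (g, h) \<otimes>\<^bsub>A\<^esub> f (g \<otimes> h, k))"
      using cl by (simp add: E.right_cancel)
    from inj_onD[OF inj this] show ?thesis
      using cl by (simp add: A.m_comm)
  qed
  then have fZ: "f \<in> Z2 G A" using f by (simp add: Z2_def)
  have "extension_class A i E p G = B2 G A #>\<^bsub>C2 G A\<^esub> f"
  proof (intro equalityI subsetI)
    fix e assume "e \<in> extension_class A i E p G"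
    then obtain t where e: "e \<in> carrier (C2 G A)" and t: "sec t" and fst: "fs t e" by (auto simp: cls)
    have "\<exists>a\<in>carrier A. t g = i a \<otimes>\<^bsub>E\<^esub> s g" if "g \<in> carrier G" for g
      using that by (intro fibre) (simp_all add: secD[OF s] secD[OF t])
    then obtain b where b: "\<And>g. g \<in> carrier G \<Longrightarrow> b g \<in> carrier A"
      and tb: "\<And>g. g \<in> carrier G \<Longrightarrow> t g = i (b g) \<otimes>\<^bsub>E\<^esub> s g" by metis
    have "e (g, h) \<otimes>\<^bsub>A\<^esub> b (g \<otimes> h) = f (g, h) \<otimes>\<^bsub>A\<^esub> (b g \<otimes>\<^bsub>A\<^esub> b h)"
      if g: "g \<in> carrier G" and h: "h \<in> carrier G" for g h
    proof -
      note cl = g h secD[OF s] C2D[OF f] C2D[OF e] b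
      have "i (e (g, h) \<otimes>\<^bsub>A\<^esub> b (g \<otimes> h)) \<otimes>\<^bsub>E\<^esub> s (g \<otimes> h) = t g \<otimes>\<^bsub>E\<^esub> t h"
        using cl fsD[OF fst g h] by (simp add: tb E.m_assoc)
      also have "\<dots> = i (b g) \<otimes>\<^bsub>E\<^esub> ((s g \<otimes>\<^bsub>E\<^esub> i (b h)) \<otimes>\<^bsub>E\<^esub> s h)"
        using cl by (simp add: tb E.m_assoc)
      also have "\<dots> = i (b g) \<otimes>\<^bsub>E\<^esub> ((i (b h) \<otimes>\<^bsub>E\<^esub> s g) \<otimes>\<^bsub>E\<^esub> s h)"
        using cl by (simp add: central[of "b h" "s g"])
      also have "\<dots> = i (b g \<otimes>\<^bsub>A\<^esub> b h \<otimes>\<^bsub>A\<^esub> f (g, h)) \<otimes>\<^bsub>E\<^esub> s (g \<otimes> h)"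
        using cl fsD[OF fsf g h] by (simp add: E.m_assoc)
      finally have "i (e (g, h) \<otimes>\<^bsub>A\<^esub> b (g \<otimes> h)) = i (b g \<otimes>\<^bsub>A\<^esub> b h \<otimes>\<^bsub>A\<^esub> f (g, h))"
        using cl by (simp add: E.right_cancel)
      from inj_onD[OF inj this] show ?thesis using cl by (simp add: A.m_comm)
    qed
    then show "e \<in> B2 G A #>\<^bsub>C2 G A\<^esub> f"
      using b by (subst mem_coset_iff[OF e f]) blast
  next
    fix e assume eB: "e \<in> B2 G A #>\<^bsub>C2 G A\<^esub> f"
    then have e: "e \<in> carrier (C2 G A)"
      using monoid.r_coset_subset_G[OF group.is_monoid[OF group_C2] subgroup.subset[OF subgroup_B2] f] by blast
    obtain b where b: "b \<in> carrier G \<rightarrow> carrier A"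
      and eq: "\<And>g h. g \<in> carrier G \<Longrightarrow> h \<in> carrier G \<Longrightarrow>
        e (g, h) \<otimes>\<^bsub>A\<^esub> b (g \<otimes> h) = f (g, h) \<otimes>\<^bsub>A\<^esub> (b g \<otimes>\<^bsub>A\<^esub> b h)"
      using eB unfolding mem_coset_iff[OF e f] by blast
    have bD: "b g \<in> carrier A" if "g \<in> carrier G" for g using b that by blast
    define t where "t g = i (b g) \<otimes>\<^bsub>E\<^esub> s g" for g
    have "sec t" by (auto simp: sec_def t_def bD secD[OF s] p_i)
    moreover have "fs t e" unfolding fs_def
    proof (intro ballI)
      fix g h assume g: "g \<in> carrier G" and h: "h \<in> carrier G"
      note cl = g h secD[OF s] C2D[OF f] C2D[OF e] bD
      have "t g \<otimes>\<^bsub>E\<^esub> t h = i (b g) \<otimes>\<^bsub>E\<^esub> ((s g \<otimes>\<^bsub>E\<^esub> i (b h)) \<otimes>\<^bsub>E\<^esub> s h)"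
        using cl by (simp add: t_def E.m_assoc)
      also have "\<dots> = i (b g) \<otimes>\<^bsub>E\<^esub> ((i (b h) \<otimes>\<^bsub>E\<^esub> s g) \<otimes>\<^bsub>E\<^esub> s h)"
        using cl by (simp add: central[of "b h" "s g"])
      also have "\<dots> = i (b g \<otimes>\<^bsub>A\<^esub> b h \<otimes>\<^bsub>A\<^esub> f (g, h)) \<otimes>\<^bsub>E\<^esub> s (g \<otimes> h)"
        using cl fsD[OF fsf g h] by (simp add: E.m_assoc)
      also have "b g \<otimes>\<^bsub>A\<^esub> b h \<otimes>\<^bsub>A\<^esub> f (g, h) = e (g, h) \<otimes>\<^bsub>A\<^esub> b (g \<otimes> h)"
        using cl eq[OF g h] by (simp add: A.m_comm)
      also have "i (e (g, h) \<otimes>\<^bsub>A\<^esub> b (g \<otimes> h)) \<otimes>\<^bsub>E\<^esub> s (g \<otimes> h) = i (e (g, h)) \<otimes>\<^bsub>E\<^esub> t (g \<otimes> h)"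
        using cl by (simp add: t_def E.m_assoc)
      finally show "t g \<otimes>\<^bsub>E\<^esub> t h = i (e (g, h)) \<otimes>\<^bsub>E\<^esub> t (g \<otimes> h)" .
    qed
    ultimately show "e \<in> extension_class A i E p G" using e by (auto simp: cls)
  qed
  then show ?thesis using fZ by (auto simp: carrier_H2)
qed

end

text \<open>For \<open>mu2\<close> centrality of the kernel is automatic.\<close>

theorem extension_class_mu2_in_H2:
  assumes ext: "group_extension mu2 i E p G"
  shows "extension_class mu2 i E p G \<in> carrier (H2 G mu2)"
proof -
  interpret G: group G using ext by (simp add: group_extension_def)
  interpret E: group E using ext by (simp add: group_extension_def)
  interpret m: comm_group mu2 by (rule mu2_comm_group)
  interpret trivial_module G mu2 by unfold_locales
  have i: "i \<in> hom mu2 E" and inj: "inj_on i (carrier mu2)" and p: "p \<in> hom E G"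
    and ker: "i ` carrier mu2 = kernel E G p"
    using ext by (auto simp: group_extension_def mon_def epi_def)
  interpret i: group_hom mu2 E i by unfold_locales (rule i)
  interpret p: group_hom E G p by unfold_locales (rule p)
  have one: "i 1 = \<one>\<^bsub>E\<^esub>" using i.hom_one by (simp add: mu2_def)
  have K: "kernel E G p = {\<one>\<^bsub>E\<^esub>, i (-1)}" using ker one by (auto simp: mu2_def)
  have z: "i (-1) \<in> carrier E" using i.hom_closed[of "-1"] by (simp add: mu2_def)
  have ne: "i (-1) \<noteq> \<one>\<^bsub>E\<^esub>" using inj_onD[OF inj, of "-1" 1] one by (auto simp: mu2_def)
  have cz: "i (-1) \<otimes>\<^bsub>E\<^esub> e = e \<otimes>\<^bsub>E\<^esub> i (-1)" if e: "e \<in> carrier E" for e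
  proof -
    let ?y = "e \<otimes>\<^bsub>E\<^esub> i (-1) \<otimes>\<^bsub>E\<^esub> inv\<^bsub>E\<^esub> e"
    have "p (i (-1)) = \<one>\<^bsub>G\<^esub>" using K by (auto simp: kernel_def)
    then have "?y \<in> kernel E G p" using e z by (simp add: kernel_def)
    moreover have "?y \<noteq> \<one>\<^bsub>E\<^esub>"
    proof
      assume "?y = \<one>\<^bsub>E\<^esub>"
      then have "e \<otimes>\<^bsub>E\<^esub> i (-1) = \<one>\<^bsub>E\<^esub> \<otimes>\<^bsub>E\<^esub> e"
        using e z by (subst (asm) E.inv_solve_right') auto
      then show False using e z ne by simp
    qed
    ultimately have "?y = i (-1)" using K by blast
    then have "e \<otimes>\<^bsub>E\<^esub> i (-1) = i (-1) \<otimes>\<^bsub>E\<^esub> e"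
      using e z by (subst (asm) E.inv_solve_right') auto
    then show ?thesis by simp
  qed
  show ?thesis
    by (rule extension_class_in_H2[OF ext]) (auto simp: mu2_def one cz)
qed

lemma (in comm_group) transversal_change:
  assumes cl: "a \<in> carrier G" "E \<in> carrier G" "P \<in> carrier G" "u \<in> carrier G" "v \<in> carrier G"
      "w \<in> carrier G" "Q \<in> carrier G" "z \<in> carrier G" "y \<in> carrier G" "a' \<in> carrier G"
    and 1: "a \<otimes> E = P \<otimes> u" and 2: "v \<otimes> Q = P \<otimes> w" and 3: "z \<otimes> Q = y \<otimes> a'"
  shows "a \<otimes> (E \<otimes> inv y) = a' \<otimes> ((u \<otimes> inv w) \<otimes> (v \<otimes> inv z))"
proof -
  have P: "P = v \<otimes> Q \<otimes> inv w" unfolding 2 using cl by (simp add: m_assoc)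
  have a': "a' = inv y \<otimes> (z \<otimes> Q)" unfolding 3 using cl by (simp flip: m_assoc)
  have "a \<otimes> (E \<otimes> inv y) = v \<otimes> Q \<otimes> inv w \<otimes> u \<otimes> inv y"
    unfolding P[symmetric] 1[symmetric] using cl by (simp add: m_assoc)
  also have "\<dots> = a' \<otimes> ((u \<otimes> inv w) \<otimes> (v \<otimes> inv z))"
  proof -
    have "z \<otimes> (inv w \<otimes> (inv y \<otimes> inv z)) = inv w \<otimes> (inv y \<otimes> (z \<otimes> inv z))"
      using cl m_lcomm[of z "inv w" "inv y \<otimes> inv z"] m_lcomm[of z "inv y" "inv z"] by simp
    then show ?thesis using cl unfolding a' by (simp add: m_ac inv_cancel_mid)
  qed
  finally show ?thesis .
qed

locale finite_index_subgroup = trivial_module +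
  fixes H
  assumes subgroup_H: "subgroup H G" and finite_rcosets: "finite (rcosets H)"
begin

lemma H_carrier: "h \<in> H \<Longrightarrow> h \<in> carrier G"
  using subgroup.mem_carrier[OF subgroup_H] .

sublocale TH: trivial_module "G\<lparr>carrier := H\<rparr>" A
  by (intro trivial_module.intro A.comm_group_axioms subgroup_imp_group subgroup_H)

lemma rcosets_sub: "U \<in> rcosets H \<Longrightarrow> U \<subseteq> carrier G"
  using subgroup.rcosets_carrier[OF subgroup_H group_axioms] .

lemma act_in: "U \<in> rcosets H \<Longrightarrow> g \<in> carrier G \<Longrightarrow> U #> g \<in> rcosets H"
  using subgroup.subset[OF subgroup_H] by (auto simp: RCOSETS_def coset_mult_assoc)

lemma act_mult: "U \<in> rcosets H \<Longrightarrow> g \<in> carrier G \<Longrightarrow> h \<in> carrier G \<Longrightarrow> U #> g #> h = U #> (g \<otimes> h)"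
  by (rule coset_mult_assoc[OF rcosets_sub])

lemma act_bij: assumes g: "g \<in> carrier G" shows "bij_betw (\<lambda>U. U #> g) (rcosets H) (rcosets H)"
  by (rule bij_betw_byWitness[where f' = "\<lambda>U. U #> inv g"])
     (auto simp: act_mult act_in g coset_mult_one rcosets_sub)

lemma finprod_act:
  assumes g: "g \<in> carrier G" and phi: "\<And>U. U \<in> rcosets H \<Longrightarrow> phi U \<in> carrier A"
  shows "(\<Otimes>\<^bsub>A\<^esub>U\<in>rcosets H. phi (U #> g)) = (\<Otimes>\<^bsub>A\<^esub>U\<in>rcosets H. phi U)"
  using A.finprod_reindex[of phi "\<lambda>U. U #> g" "rcosets H"] act_bij[OF g] phi
  by (auto simp: bij_betw_def)

context
  fixes s assumes s: "s \<in> transversals G H"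
begin

lemma trans_mem: "U \<in> rcosets H \<Longrightarrow> s U \<in> U"
  using s by (auto simp: transversals_def)

lemma trans_carrier: "U \<in> rcosets H \<Longrightarrow> s U \<in> carrier G"
  using trans_mem rcosets_sub by blast

lemma trans_coset: assumes U: "U \<in> rcosets H" shows "U = H #> s U"
proof -
  obtain x where x: "x \<in> carrier G" "U = H #> x" using U by (auto simp: RCOSETS_def)
  show ?thesis using repr_independence[OF _ x(1) subgroup_H] trans_mem[OF U] x by simp
qed

lemma transfer_H:
  assumes U: "U \<in> rcosets H" and g: "g \<in> carrier G" shows "transfer_elt G s U g \<in> H"
proof -
  have "s U \<otimes> g \<in> U #> g" using trans_mem[OF U] by (auto simp: r_coset_def)
  also have "U #> g = H #> s (U #> g)" using trans_coset act_in[OF U g] by blast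
  finally show ?thesis
    using subgroup.rcos_module_imp[OF subgroup_H group_axioms trans_carrier[OF act_in[OF U g]]]
    by (simp add: transfer_elt_def)
qed

lemma transfer_mult:
  assumes U: "U \<in> rcosets H" and g: "g \<in> carrier G" and h: "h \<in> carrier G"
  shows "transfer_elt G s U (g \<otimes> h) = transfer_elt G s U g \<otimes> transfer_elt G s (U #> g) h"
proof -
  have c: "s U \<in> carrier G" "s (U #> g) \<in> carrier G" "s (U #> (g \<otimes> h)) \<in> carrier G"
    using U g h by (simp_all add: trans_carrier act_in)
  have "inv s (U #> g) \<otimes> (s (U #> g) \<otimes> y) = y" if "y \<in> carrier G" for y
    using that c by (simp flip: m_assoc)
  then show ?thesis using c g h U by (simp add: transfer_elt_def m_assoc act_mult)
qed

lemma cor_cochain_apply: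
  assumes "g \<in> carrier G" "h \<in> carrier G"
  shows "cor_cochain G H A s f (g, h) =
    (\<Otimes>\<^bsub>A\<^esub>U\<in>rcosets H. f (transfer_elt G s U g, transfer_elt G s (U #> g) h))"
  using assms by (simp add: cor_cochain_def)

lemma cor_cochain_C2:
  assumes f: "f \<in> carrier (C2 (G\<lparr>carrier := H\<rparr>) A)" shows "cor_cochain G H A s f \<in> carrier (C2 G A)"
proof -
  have "f (transfer_elt G s U g, transfer_elt G s (U #> g) h) \<in> carrier A"
    if "U \<in> rcosets H" "g \<in> carrier G" "h \<in> carrier G" for U g h
    using that by (intro TH.C2D[OF f]) (simp_all add: transfer_H act_in)
  then show ?thesis
    unfolding C2_def cor_cochain_def by (auto intro!: A.finprod_closed)
qed

lemma cor_cochain_Z2: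
  assumes f: "f \<in> Z2 (G\<lparr>carrier := H\<rparr>) A" shows "cor_cochain G H A s f \<in> Z2 G A"
proof -
  let ?a = "transfer_elt G s"
  have "cor_cochain G H A s f (h, k) \<otimes>\<^bsub>A\<^esub> cor_cochain G H A s f (g, h \<otimes> k)
      = cor_cochain G H A s f (g \<otimes> h, k) \<otimes>\<^bsub>A\<^esub> cor_cochain G H A s f (g, h)"
    if g: "g \<in> carrier G" and h: "h \<in> carrier G" and k: "k \<in> carrier G" for g h k
  proof -
    have fin: "f (?a U x, ?a V y) \<in> carrier A"
      if "U \<in> rcosets H" "V \<in> rcosets H" "x \<in> carrier G" "y \<in> carrier G" for U V x y
      using that by (intro TH.Z2D[OF f]) (simp_all add: transfer_H)
    have "cor_cochain G H A s f (h, k) =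
        (\<Otimes>\<^bsub>A\<^esub>U\<in>rcosets H. f (?a (U #> g) h, ?a (U #> g #> h) k))"
      unfolding cor_cochain_apply[OF h k]
      by (rule finprod_act[OF g, symmetric]) (simp add: fin act_in h k)
    then have "cor_cochain G H A s f (h, k) \<otimes>\<^bsub>A\<^esub> cor_cochain G H A s f (g, h \<otimes> k) =
        (\<Otimes>\<^bsub>A\<^esub>U\<in>rcosets H. f (?a (U #> g) h, ?a (U #> g #> h) k) \<otimes>\<^bsub>A\<^esub> f (?a U g, ?a (U #> g) (h \<otimes> k)))"
      using g h k by (simp add: cor_cochain_apply A.finprod_multf fin act_in Pi_iff)
    also have "\<dots> = (\<Otimes>\<^bsub>A\<^esub>U\<in>rcosets H. f (?a U (g \<otimes> h), ?a (U #> (g \<otimes> h)) k) \<otimes>\<^bsub>A\<^esub> f (?a U g, ?a (U #> g) h))"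
    proof (rule A.finprod_cong')
      fix U assume U: "U \<in> rcosets H"
      show "f (?a (U #> g) h, ?a (U #> g #> h) k) \<otimes>\<^bsub>A\<^esub> f (?a U g, ?a (U #> g) (h \<otimes> k))
          = f (?a U (g \<otimes> h), ?a (U #> (g \<otimes> h)) k) \<otimes>\<^bsub>A\<^esub> f (?a U g, ?a (U #> g) h)"
        using TH.Z2_eq[OF f, of "?a U g" "?a (U #> g) h" "?a (U #> g #> h) k"] U g h k
        by (simp add: transfer_H act_in transfer_mult act_mult)
    qed (use g h k in \<open>auto simp: fin act_in\<close>)
    also have "\<dots> = cor_cochain G H A s f (g \<otimes> h, k) \<otimes>\<^bsub>A\<^esub> cor_cochain G H A s f (g, h)"
      using g h k by (simp add: cor_cochain_apply A.finprod_multf fin act_in Pi_iff)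
    finally show ?thesis .
  qed
  then show ?thesis using cor_cochain_C2[OF TH.Z2_C2[OF f]] by (simp add: Z2_def)
qed

lemma cor_cochain_mult:
  assumes e: "e \<in> carrier (C2 (G\<lparr>carrier := H\<rparr>) A)" and f: "f \<in> carrier (C2 (G\<lparr>carrier := H\<rparr>) A)"
  shows "cor_cochain G H A s (e \<otimes>\<^bsub>C2 (G\<lparr>carrier := H\<rparr>) A\<^esub> f)
    = cor_cochain G H A s e \<otimes>\<^bsub>C2 G A\<^esub> cor_cochain G H A s f"
proof (rule C2_eqI)
  have ef: "e \<otimes>\<^bsub>C2 (G\<lparr>carrier := H\<rparr>) A\<^esub> f \<in> carrier (C2 (G\<lparr>carrier := H\<rparr>) A)"
    using e f monoid.m_closed[OF group.is_monoid[OF TH.group_C2]] by blast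
  show "cor_cochain G H A s (e \<otimes>\<^bsub>C2 (G\<lparr>carrier := H\<rparr>) A\<^esub> f) \<in> carrier (C2 G A)"
    by (rule cor_cochain_C2[OF ef])
  show "cor_cochain G H A s e \<otimes>\<^bsub>C2 G A\<^esub> cor_cochain G H A s f \<in> carrier (C2 G A)"
    using cor_cochain_C2[OF e] cor_cochain_C2[OF f] monoid.m_closed[OF group.is_monoid[OF group_C2]] by blast
  fix g h assume gh: "g \<in> carrier G" "h \<in> carrier G"
  have fin: "f (transfer_elt G s U x, transfer_elt G s V y) \<in> carrier A"
      "e (transfer_elt G s U x, transfer_elt G s V y) \<in> carrier A"
    if "U \<in> rcosets H" "V \<in> rcosets H" "x \<in> carrier G" "y \<in> carrier G" for U V x y
    using that TH.C2D[OF f] TH.C2D[OF e] by (simp_all add: transfer_H)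
  have "cor_cochain G H A s (e \<otimes>\<^bsub>C2 (G\<lparr>carrier := H\<rparr>) A\<^esub> f) (g, h) =
      (\<Otimes>\<^bsub>A\<^esub>U\<in>rcosets H. e (transfer_elt G s U g, transfer_elt G s (U #> g) h)
        \<otimes>\<^bsub>A\<^esub> f (transfer_elt G s U g, transfer_elt G s (U #> g) h))"
    unfolding cor_cochain_apply[OF gh]
    by (rule A.finprod_cong') (auto simp: fin act_in gh TH.C2_mult_apply transfer_H)
  also have "\<dots> = cor_cochain G H A s e (g, h) \<otimes>\<^bsub>A\<^esub> cor_cochain G H A s f (g, h)"
    unfolding cor_cochain_apply[OF gh] by (rule A.finprod_multf) (auto simp: fin act_in gh)
  finally show "cor_cochain G H A s (e \<otimes>\<^bsub>C2 (G\<lparr>carrier := H\<rparr>) A\<^esub> f) (g, h)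
    = (cor_cochain G H A s e \<otimes>\<^bsub>C2 G A\<^esub> cor_cochain G H A s f) (g, h)"
    by (simp add: C2_mult_apply gh)
qed

lemma cor_cochain_cohomologous:
  assumes f: "f \<in> carrier (C2 (G\<lparr>carrier := H\<rparr>) A)" and e: "e \<in> B2 (G\<lparr>carrier := H\<rparr>) A #>\<^bsub>C2 (G\<lparr>carrier := H\<rparr>) A\<^esub> f"
  shows "cor_cochain G H A s e \<in> B2 G A #>\<^bsub>C2 G A\<^esub> cor_cochain G H A s f"
proof -
  let ?a = "transfer_elt G s"
  have eC: "e \<in> carrier (C2 (G\<lparr>carrier := H\<rparr>) A)"
    using e monoid.r_coset_subset_G[OF group.is_monoid[OF TH.group_C2] subgroup.subset[OF TH.subgroup_B2] f] by blast
  obtain b where b: "b \<in> H \<rightarrow> carrier A"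
    and eq: "\<And>g h. g \<in> H \<Longrightarrow> h \<in> H \<Longrightarrow>
        e (g, h) \<otimes>\<^bsub>A\<^esub> b (g \<otimes> h) = f (g, h) \<otimes>\<^bsub>A\<^esub> (b g \<otimes>\<^bsub>A\<^esub> b h)"
    using e unfolding TH.mem_coset_iff[OF eC f] by auto
  have bD: "b g \<in> carrier A" if "g \<in> H" for g using b that by blast
  have fin: "f (?a U x, ?a V y) \<in> carrier A" "e (?a U x, ?a V y) \<in> carrier A"
    if "U \<in> rcosets H" "V \<in> rcosets H" "x \<in> carrier G" "y \<in> carrier G" for U V x y
    using that TH.C2D[OF f] TH.C2D[OF eC] by (simp_all add: transfer_H)
  define B where "B g = (\<Otimes>\<^bsub>A\<^esub>U\<in>rcosets H. b (?a U g))" for g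
  have "cor_cochain G H A s e (g, h) \<otimes>\<^bsub>A\<^esub> B (g \<otimes> h)
      = cor_cochain G H A s f (g, h) \<otimes>\<^bsub>A\<^esub> (B g \<otimes>\<^bsub>A\<^esub> B h)"
    if g: "g \<in> carrier G" and h: "h \<in> carrier G" for g h
  proof -
    have Bh: "B h = (\<Otimes>\<^bsub>A\<^esub>U\<in>rcosets H. b (?a (U #> g) h))"
      unfolding B_def by (rule finprod_act[OF g, symmetric]) (simp add: bD transfer_H h)
    have "cor_cochain G H A s e (g, h) \<otimes>\<^bsub>A\<^esub> B (g \<otimes> h)
        = (\<Otimes>\<^bsub>A\<^esub>U\<in>rcosets H. e (?a U g, ?a (U #> g) h) \<otimes>\<^bsub>A\<^esub> b (?a U (g \<otimes> h)))"
      using g h by (simp add: cor_cochain_apply B_def A.finprod_multf fin act_in Pi_iff bD transfer_H)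
    also have "\<dots> = (\<Otimes>\<^bsub>A\<^esub>U\<in>rcosets H. f (?a U g, ?a (U #> g) h) \<otimes>\<^bsub>A\<^esub> (b (?a U g) \<otimes>\<^bsub>A\<^esub> b (?a (U #> g) h)))"
      by (rule A.finprod_cong') (use g h in \<open>auto simp: eq[symmetric] transfer_mult transfer_H act_in fin bD\<close>)
    also have "\<dots> = cor_cochain G H A s f (g, h) \<otimes>\<^bsub>A\<^esub> (B g \<otimes>\<^bsub>A\<^esub> B h)"
      unfolding Bh using g h by (simp add: cor_cochain_apply B_def A.finprod_multf fin act_in Pi_iff bD transfer_H)
    finally show ?thesis .
  qed
  moreover have "B \<in> carrier G \<rightarrow> carrier A"
    by (auto simp: B_def bD transfer_H intro!: A.finprod_closed)
  ultimately show ?thesis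
    unfolding mem_coset_iff[OF cor_cochain_C2[OF eC] cor_cochain_C2[OF f]] by blast
qed

end

lemma cor_cochain_transversal_indep:
  assumes s: "s \<in> transversals G H" and t: "t \<in> transversals G H" and f: "f \<in> Z2 (G\<lparr>carrier := H\<rparr>) A"
  shows "cor_cochain G H A s f \<in> B2 G A #>\<^bsub>C2 G A\<^esub> cor_cochain G H A t f"
proof -
  let ?a = "transfer_elt G s" and ?a' = "transfer_elt G t"
  define k where "k U = t U \<otimes> inv (s U)" for U
  have tH: "?a U g \<in> H" "?a' U g \<in> H" if "U \<in> rcosets H" "g \<in> carrier G" for U g
    using that transfer_H[OF s] transfer_H[OF t] by auto
  have kH: "k U \<in> H" if U: "U \<in> rcosets H" for U
    using subgroup.rcos_module_imp[OF subgroup_H group_axioms trans_carrier[OF s U], of "t U"]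
      trans_mem[OF t U] trans_coset[OF s U] by (simp add: k_def)
  have comm: "k U \<otimes> ?a U g = ?a' U g \<otimes> k (U #> g)" if U: "U \<in> rcosets H" and g: "g \<in> carrier G" for U g
  proof -
    have c: "s U \<in> carrier G" "t U \<in> carrier G" "s (U #> g) \<in> carrier G" "t (U #> g) \<in> carrier G"
      using U g by (simp_all add: trans_carrier[OF s] trans_carrier[OF t] act_in)
    have *: "inv x \<otimes> (x \<otimes> y) = y" if "x \<in> carrier G" "y \<in> carrier G" for x y
      using that by (simp flip: m_assoc)
    show ?thesis using c g by (simp add: k_def transfer_elt_def m_assoc *)
  qed
  have fD: "f (x, y) \<in> carrier A" if "x \<in> H" "y \<in> H" for x y
    using TH.Z2D[OF f] that by simp
  have cl: "x \<otimes> y \<in> H" if "x \<in> H" "y \<in> H" for x y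
    using subgroup.m_closed[OF subgroup_H] that by blast
  define \<beta> where "\<beta> U g = f (k U, ?a U g) \<otimes>\<^bsub>A\<^esub> inv\<^bsub>A\<^esub> f (?a' U g, k (U #> g))" for U g
  have \<beta>D: "\<beta> U g \<in> carrier A" if "U \<in> rcosets H" "g \<in> carrier G" for U g
    using that by (simp add: \<beta>_def fD tH kH act_in)
  have pointwise: "f (?a U g, ?a (U #> g) h) \<otimes>\<^bsub>A\<^esub> \<beta> U (g \<otimes> h)
      = f (?a' U g, ?a' (U #> g) h) \<otimes>\<^bsub>A\<^esub> (\<beta> U g \<otimes>\<^bsub>A\<^esub> \<beta> (U #> g) h)"
    if U: "U \<in> rcosets H" and g: "g \<in> carrier G" and h: "h \<in> carrier G" for U g h
  proof -
    have U': "U #> g \<in> rcosets H" "U #> g #> h \<in> rcosets H" using U g h by (simp_all add: act_in)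
    note m = tH[OF U g] tH[OF U'(1) h] kH[OF U] kH[OF U'(1)] kH[OF U'(2)] cl fD
    have tm: "?a U (g \<otimes> h) = ?a U g \<otimes> ?a (U #> g) h" "?a' U (g \<otimes> h) = ?a' U g \<otimes> ?a' (U #> g) h"
      using transfer_mult[OF s U g h] transfer_mult[OF t U g h] by auto
    have z: "f (y, z) \<otimes>\<^bsub>A\<^esub> f (x, y \<otimes> z) = f (x \<otimes> y, z) \<otimes>\<^bsub>A\<^esub> f (x, y)"
      if "x \<in> H" "y \<in> H" "z \<in> H" for x y z using TH.Z2_eq[OF f, of x y z] that by simp
    show ?thesis
      unfolding \<beta>_def tm act_mult[OF U g h, symmetric]
    proof (rule A.transversal_change[where P = "f (k U \<otimes> ?a U g, ?a (U #> g) h)"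
          and Q = "f (?a' U g, k (U #> g) \<otimes> ?a (U #> g) h)"])
      show "f (?a U g, ?a (U #> g) h) \<otimes>\<^bsub>A\<^esub> f (k U, ?a U g \<otimes> ?a (U #> g) h) =
          f (k U \<otimes> ?a U g, ?a (U #> g) h) \<otimes>\<^bsub>A\<^esub> f (k U, ?a U g)"
        by (rule z) (use m in auto)
      show "f (k (U #> g), ?a (U #> g) h) \<otimes>\<^bsub>A\<^esub> f (?a' U g, k (U #> g) \<otimes> ?a (U #> g) h) =
          f (k U \<otimes> ?a U g, ?a (U #> g) h) \<otimes>\<^bsub>A\<^esub> f (?a' U g, k (U #> g))"
        unfolding comm[OF U g] by (rule z) (use m in auto)
      show "f (?a' (U #> g) h, k (U #> g #> h)) \<otimes>\<^bsub>A\<^esub> f (?a' U g, k (U #> g) \<otimes> ?a (U #> g) h) =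
          f (?a' U g \<otimes> ?a' (U #> g) h, k (U #> g #> h)) \<otimes>\<^bsub>A\<^esub> f (?a' U g, ?a' (U #> g) h)"
        unfolding comm[OF U'(1) h] by (rule z) (use m in auto)
    qed (use m in auto)
  qed
  define B where "B g = (\<Otimes>\<^bsub>A\<^esub>U\<in>rcosets H. \<beta> U g)" for g
  have "cor_cochain G H A s f (g, h) \<otimes>\<^bsub>A\<^esub> B (g \<otimes> h)
      = cor_cochain G H A t f (g, h) \<otimes>\<^bsub>A\<^esub> (B g \<otimes>\<^bsub>A\<^esub> B h)"
    if g: "g \<in> carrier G" and h: "h \<in> carrier G" for g h
  proof -
    have Bh: "B h = (\<Otimes>\<^bsub>A\<^esub>U\<in>rcosets H. \<beta> (U #> g) h)"
      unfolding B_def by (rule finprod_act[OF g, symmetric]) (simp add: \<beta>D h)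
    have "cor_cochain G H A s f (g, h) \<otimes>\<^bsub>A\<^esub> B (g \<otimes> h)
        = (\<Otimes>\<^bsub>A\<^esub>U\<in>rcosets H. f (?a U g, ?a (U #> g) h) \<otimes>\<^bsub>A\<^esub> \<beta> U (g \<otimes> h))"
      using g h by (simp add: cor_cochain_apply[OF s] B_def A.finprod_multf fD act_in Pi_iff \<beta>D tH)
    also have "\<dots> = (\<Otimes>\<^bsub>A\<^esub>U\<in>rcosets H. f (?a' U g, ?a' (U #> g) h) \<otimes>\<^bsub>A\<^esub> (\<beta> U g \<otimes>\<^bsub>A\<^esub> \<beta> (U #> g) h))"
      by (rule A.finprod_cong') (use g h in \<open>auto simp: pointwise fD tH \<beta>D act_in\<close>)
    also have "\<dots> = cor_cochain G H A t f (g, h) \<otimes>\<^bsub>A\<^esub> (B g \<otimes>\<^bsub>A\<^esub> B h)"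
      unfolding Bh using g h by (simp add: cor_cochain_apply[OF t] B_def A.finprod_multf fD act_in Pi_iff \<beta>D tH)
    finally show ?thesis .
  qed
  moreover have "B \<in> carrier G \<rightarrow> carrier A"
    by (auto simp: B_def \<beta>D intro!: A.finprod_closed)
  ultimately show ?thesis
    using mem_coset_iff[OF cor_cochain_C2[OF s TH.Z2_C2[OF f]] cor_cochain_C2[OF t TH.Z2_C2[OF f]]] by blast
qed

lemma transversals_nonempty: "transversals G H \<noteq> {}"
proof -
  have "(\<lambda>U. SOME x. x \<in> U) \<in> transversals G H"
    using subgroup.rcosets_non_empty[OF subgroup_H] by (auto simp: transversals_def some_in_eq)
  then show ?thesis by blast
qed

theorem corestriction_coset:
  assumes f: "f \<in> Z2 (G\<lparr>carrier := H\<rparr>) A" and s: "s \<in> transversals G H"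
  shows "corestriction G H A (B2 (G\<lparr>carrier := H\<rparr>) A #>\<^bsub>C2 (G\<lparr>carrier := H\<rparr>) A\<^esub> f)
    = B2 G A #>\<^bsub>C2 G A\<^esub> cor_cochain G H A s f"
proof -
  let ?c = "B2 (G\<lparr>carrier := H\<rparr>) A #>\<^bsub>C2 (G\<lparr>carrier := H\<rparr>) A\<^esub> f"
  have "B2 G A #>\<^bsub>C2 G A\<^esub> cor_cochain G H A t e = B2 G A #>\<^bsub>C2 G A\<^esub> cor_cochain G H A s f"
    if t: "t \<in> transversals G H" and e: "e \<in> ?c" for t e
    using coset_eqI[OF cor_cochain_C2[OF t TH.Z2_C2[OF f]] cor_cochain_cohomologous[OF t TH.Z2_C2[OF f] e]]
      coset_eqI[OF cor_cochain_C2[OF s TH.Z2_C2[OF f]] cor_cochain_transversal_indep[OF t s f]] by simp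
  moreover have "f \<in> ?c" by (rule TH.coset_self[OF TH.Z2_C2[OF f]])
  ultimately show ?thesis using s unfolding corestriction_def by blast
qed

theorem corestriction_hom:
  "corestriction G H A \<in> hom (H2 (G\<lparr>carrier := H\<rparr>) A) (H2 G A)"
proof -
  obtain s where s: "s \<in> transversals G H" using transversals_nonempty by blast
  show ?thesis
  proof (rule homI)
    fix c assume "c \<in> carrier (H2 (G\<lparr>carrier := H\<rparr>) A)"
    then show "corestriction G H A c \<in> carrier (H2 G A)"
      using corestriction_coset[OF _ s] cor_cochain_Z2[OF s] by (auto simp: TH.carrier_H2 carrier_H2)
  next
    fix c d assume "c \<in> carrier (H2 (G\<lparr>carrier := H\<rparr>) A)" "d \<in> carrier (H2 (G\<lparr>carrier := H\<rparr>) A)"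
    then obtain e f where e: "e \<in> Z2 (G\<lparr>carrier := H\<rparr>) A" and f: "f \<in> Z2 (G\<lparr>carrier := H\<rparr>) A"
      and c: "c = B2 (G\<lparr>carrier := H\<rparr>) A #>\<^bsub>C2 (G\<lparr>carrier := H\<rparr>) A\<^esub> e"
      and d: "d = B2 (G\<lparr>carrier := H\<rparr>) A #>\<^bsub>C2 (G\<lparr>carrier := H\<rparr>) A\<^esub> f"
      by (auto simp: TH.carrier_H2)
    have ef: "e \<otimes>\<^bsub>C2 (G\<lparr>carrier := H\<rparr>) A\<^esub> f \<in> Z2 (G\<lparr>carrier := H\<rparr>) A"
      using subgroup.m_closed[OF TH.subgroup_Z2 e f] .
    show "corestriction G H A (c \<otimes>\<^bsub>H2 (G\<lparr>carrier := H\<rparr>) A\<^esub> d)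
        = corestriction G H A c \<otimes>\<^bsub>H2 G A\<^esub> corestriction G H A d"
      unfolding c d TH.H2_mult[OF e f] corestriction_coset[OF ef s] corestriction_coset[OF e s]
        corestriction_coset[OF f s] H2_mult[OF cor_cochain_Z2[OF s e] cor_cochain_Z2[OF s f]]
        cor_cochain_mult[OF s TH.Z2_C2[OF e] TH.Z2_C2[OF f]] ..
  qed
qed

end

end

theory Submission
  imports Defs "HOL-Algebra.Multiplicative_Group"
begin

text \<open>Let \<open>\<sigma>\<close> generate the cyclic subgroup, let \<open>g\<close> be its image in \<open>G\<close> and \<open>m = 2 ^ (n - 2)\<close>. As
  \<open>G1\<close> is not abelian, the kernel lies in \<open>\<langle>\<sigma>\<rangle>\<close>, so \<open>g\<close> has order \<open>m\<close> and every lift of \<open>g\<close> has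
  \<open>m\<close>-th power \<open>\<sigma> ^ m = i (-1)\<close>. For a factor set \<open>f\<close> of the extension this reads
  \<open>\<Prod>j<m. f (g ^ j, g) = -1\<close>. For a corestricted cocycle the product is \<open>1\<close>. If \<open>g \<notin> H\<close>, then \<open>g\<close>
  swaps the two cosets of \<open>H\<close> and the factors cancel in pairs. If \<open>g \<in> H\<close>, then \<open>H = \<langle>g\<rangle>\<close> and the
  product is the value at \<open>g\<close> of the analogous product on \<open>H\<close> times its value at a conjugate
  \<open>g ^ k\<close>, where \<open>k\<close> is odd; the second value is the \<open>k\<close>-th power of the first.\<close>

section \<open>Products of a cocycle along the powers of an element\<close>

text \<open>For a section \<open>s\<close> with factor set \<open>f\<close>, this sign compares
  \<open>s x\<close> to the power \<open>l\<close> with \<open>s\<close> of the power. If the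
  \<open>m\<close>-th power of \<open>x\<close> is \<one> and \<open>m\<close> is even, the value at
  \<open>m\<close> is unchanged by coboundaries.\<close>

definition power_cocycle :: "('g, 'm) monoid_scheme \<Rightarrow> ('g \<times> 'g \<Rightarrow> int) \<Rightarrow> 'g \<Rightarrow> nat \<Rightarrow> int" where
  "power_cocycle G f x l = (\<Prod>j<l. f (x [^]\<^bsub>G\<^esub> j, x))"

lemma power_cocycle_0 [simp]: "power_cocycle G f x 0 = 1"
  by (simp add: power_cocycle_def)

lemma power_cocycle_Suc [simp]:
  "power_cocycle G f x (Suc l) = power_cocycle G f x l * f (x [^]\<^bsub>G\<^esub> l, x)"
  by (simp add: power_cocycle_def)

lemma mu2_mem: "a \<in> carrier mu2 \<longleftrightarrow> a = 1 \<or> a = -1"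
  by (auto simp: mu2_def)

lemma mu2_mult [simp]: "a \<otimes>\<^bsub>mu2\<^esub> b = a * b"
  by (simp add: mu2_def)

lemma mu2_one [simp]: "\<one>\<^bsub>mu2\<^esub> = 1"
  by (simp add: mu2_def)

lemma mu2_square: "a \<in> carrier mu2 \<Longrightarrow> a * a = 1"
  by (auto simp: mu2_mem)

lemma mu2_times: "a \<in> carrier mu2 \<Longrightarrow> b \<in> carrier mu2 \<Longrightarrow> a * b \<in> carrier mu2"
  by (auto simp: mu2_mem)

context group
begin

lemma trivial_module_mu2: "trivial_module G mu2"
  by (intro trivial_module.intro mu2_comm_group is_group)

lemma Z2_mu2D: "f \<in> Z2 G mu2 \<Longrightarrow> x \<in> carrier G \<Longrightarrow> y \<in> carrier G \<Longrightarrow> f (x, y) \<in> carrier mu2"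
  by (rule trivial_module.Z2D[OF trivial_module_mu2])

text \<open>Signs are their own inverses, so the cocycle identity can be solved for one term without
  inverses; this shape suits induction on the second argument.\<close>

lemma Z2_mu2_eq:
  assumes "f \<in> Z2 G mu2" "x \<in> carrier G" "y \<in> carrier G" "z \<in> carrier G"
  shows "f (x, y \<otimes> z) = f (y, z) * f (x \<otimes> y, z) * f (x, y)"
proof -
  have "f (y, z) * f (x, y \<otimes> z) = f (x \<otimes> y, z) * f (x, y)"
    using trivial_module.Z2_eq[OF trivial_module_mu2 assms] by simp
  then have "f (y, z) * f (y, z) * f (x, y \<otimes> z) = f (y, z) * f (x \<otimes> y, z) * f (x, y)"
    by (simp add: mult.assoc)
  then show ?thesis
    using mu2_square[OF Z2_mu2D[of f y z]] assms by simp
qed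

text \<open>Cocycles are not normalised here, so the constant \<open>f (\<one>, \<one>)\<close> has
  to be carried along.\<close>

lemma Z2_mu2_one:
  assumes "f \<in> Z2 G mu2" "x \<in> carrier G"
  shows "f (x, \<one>) = f (\<one>, \<one>)"
  using Z2_mu2_eq[of f x \<one> \<one>] mu2_square[OF Z2_mu2D[of f x \<one>]] assms
  by (simp add: mult.assoc)

lemma power_cocycle_mem:
  assumes "f \<in> carrier (C2 G mu2)" "x \<in> carrier G"
  shows "power_cocycle G f x l \<in> carrier mu2"
proof (induction l)
  case (Suc l)
  then show ?case
    using trivial_module.C2D[OF trivial_module_mu2 assms(1), of "x [^] l" x] assms(2)
    by (simp add: mu2_times)
qed (simp add: mu2_mem)

text \<open>Pulled back to exponents in \<nat>, a cocycle becomes a coboundary: up to the constant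
  \<open>f (\<one>, \<one>)\<close> it is the coboundary of
  \<open>power_cocycle G f x\<close>.\<close>

lemma cocycle_power_power:
  assumes f: "f \<in> Z2 G mu2" and x: "x \<in> carrier G"
  shows "f (x [^] (a::nat), x [^] (b::nat)) =
    f (\<one>, \<one>) * power_cocycle G f x (a + b) * power_cocycle G f x a * power_cocycle G f x b"
proof (induction b)
  case 0
  have "power_cocycle G f x a * power_cocycle G f x a = 1"
    by (intro mu2_square power_cocycle_mem x trivial_module.Z2_C2[OF trivial_module_mu2 f])
  then show ?case
    using Z2_mu2_one[OF f, of "x [^] a"] x by (simp add: mult.assoc)
next
  case (Suc b)
  have "f (x [^] a, x [^] Suc b) = f (x [^] b, x) * f (x [^] (a + b), x) * f (x [^] a, x [^] b)"
    using Z2_mu2_eq[OF f, of "x [^] a" "x [^] b" x] x by (simp add: nat_pow_mult)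
  then show ?case
    unfolding Suc by (simp add: mult_ac)
qed

text \<open>The factors \<open>f (x [^] j, x)\<close> are periodic in \<open>j\<close> with period
  \<open>m\<close>.\<close>

lemma power_cocycle_period:
  assumes x: "x \<in> carrier G" and "x [^] (m::nat) = \<one>"
  shows "power_cocycle G f x (m * k) = power_cocycle G f x m ^ k"
proof (induction k)
  case (Suc k)
  have "power_cocycle G f x (m * k + l) = power_cocycle G f x (m * k) * power_cocycle G f x l" for l
  proof (induction l)
    case (Suc l)
    have "x [^] (m * k + l) = x [^] l"
      using assms by (simp add: nat_pow_mult[symmetric] nat_pow_pow[symmetric])
    then show ?case using Suc by simp
  qed simp
  from this[of m] Suc show ?case by (simp add: add.commute)
qed simp

lemma power_cocycle_pow:
  assumes f: "f \<in> Z2 G mu2" and x: "x \<in> carrier G" and xm: "x [^] m = \<one>" and m: "even m"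
  shows "power_cocycle G f (x [^] (k::nat)) m = power_cocycle G f x m ^ k"
proof -
  let ?P = "power_cocycle G f x"
  have sq: "?P l * ?P l = 1" for l
    by (intro mu2_square power_cocycle_mem x trivial_module.Z2_C2[OF trivial_module_mu2 f])
  \<comment> \<open>By \<open>cocycle_power_power\<close> with exponents \<open>k * l\<close> and
    \<open>k\<close> the product telescopes, leaving one sign
    \<open>f (\<one>, \<one>) * ?P k\<close> per factor. For \<open>l = m\<close> these signs cancel
    because \<open>m\<close> is even.\<close>
  have "power_cocycle G f (x [^] k) l = (f (\<one>, \<one>) * ?P k) ^ l * ?P (k * l)" for l
  proof (induction l)
    case (Suc l)
    have "f ((x [^] k) [^] l, x [^] k) = f (\<one>, \<one>) * ?P (k * l + k) * ?P (k * l) * ?P k"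
      using cocycle_power_power[OF f x, of "k * l" k] x by (simp add: nat_pow_pow)
    with Suc sq[of "k * l"] show ?case
      by (simp add: mult_ac add.commute)
  qed simp
  moreover have "(f (\<one>, \<one>) * ?P k) ^ m = 1"
  proof -
    have "f (\<one>, \<one>) * ?P k \<in> carrier mu2"
      by (intro mu2_times Z2_mu2D[OF f] power_cocycle_mem x
          trivial_module.Z2_C2[OF trivial_module_mu2 f] one_closed)
    then show ?thesis using m by (auto simp: mu2_mem)
  qed
  ultimately show ?thesis
    using power_cocycle_period[OF x xm, of f k] by (simp add: mult.commute)
qed

end

section \<open>Explicit corestriction from a subgroup of index 2\<close>

locale index_two_subgroup = finite_index_subgroup G mu2 H for G (structure) and H +
  fixes t
  assumes card_rcosets: "card (rcosets H) = 2" and t_carrier: "t \<in> carrier G" and t_notin: "t \<notin> H"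
begin

lemma H_rcoset: "H \<in> rcosets H"
  using rcosetsI[OF subgroup.subset[OF subgroup_H] one_closed] subgroup.subset[OF subgroup_H]
  by (simp add: coset_mult_one)

lemma t_rcoset: "H #> t \<in> rcosets H"
  using rcosetsI[OF subgroup.subset[OF subgroup_H] t_carrier] .

lemma t_mem: "t \<in> H #> t"
  using rcos_self[OF t_carrier subgroup_H] .

lemma H_neq: "H \<noteq> H #> t"
  using t_mem t_notin by blast

lemma rcosets_eq: "rcosets H = {H, H #> t}"
  using card_seteq[OF finite_rcosets, of "{H, H #> t}"] H_rcoset t_rcoset H_neq card_rcosets
  by simp

lemma act_H: "g \<in> H \<Longrightarrow> H #> g = H"
  using coset_join2[of g H] subgroup_H H_carrier by simp

lemma act_inj: "U \<in> rcosets H \<Longrightarrow> V \<in> rcosets H \<Longrightarrow> g \<in> carrier G \<Longrightarrow> U #> g = V #> g \<Longrightarrow> U = V"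
  using act_bij[of g] by (auto simp: bij_betw_def dest: inj_onD)

text \<open>Right multiplication permutes the two cosets; as \<open>g\<close> fixes
  \<open>H\<close>, it fixes the other one too.\<close>

lemma act_coset:
  assumes g: "g \<in> H" shows "H #> t #> g = H #> t"
  using act_in[OF t_rcoset H_carrier[OF g]] act_inj[OF H_rcoset t_rcoset H_carrier[OF g]]
    H_neq act_H[OF g] unfolding rcosets_eq by auto

lemma act_swap: "H #> t #> t = H"
  using act_in[OF t_rcoset t_carrier] act_inj[OF H_rcoset t_rcoset t_carrier] H_neq
  unfolding rcosets_eq by auto

text \<open>The corestricted class is the same for all transversals. With this one the transfer
  elements of \<open>g \<in> H\<close> are \<open>g\<close> and its conjugate by \<open>t\<close>,
  and those of \<open>t\<close> are \<one> and \<open>t \<otimes> t\<close>.\<close>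

definition s where "s = (\<lambda>U\<in>rcosets H. if U = H then \<one> else t)"

lemma s_transversal: "s \<in> transversals G H"
  using t_mem subgroup.one_closed[OF subgroup_H]
  by (auto simp: s_def transversals_def rcosets_eq)

lemma s_H [simp]: "s H = \<one>"
  using H_rcoset by (simp add: s_def)

lemma s_t [simp]: "s (H #> t) = t"
  using t_rcoset H_neq by (simp add: s_def)

lemma cor_apply:
  assumes f: "f \<in> carrier (C2 (G\<lparr>carrier := H\<rparr>) mu2)" and "g \<in> carrier G" "h \<in> carrier G"
  shows "cor_cochain G H mu2 s f (g, h) =
    f (transfer_elt G s H g, transfer_elt G s (H #> g) h) *
    f (transfer_elt G s (H #> t) g, transfer_elt G s (H #> t #> g) h)"
proof -
  have "f (transfer_elt G s U g, transfer_elt G s (U #> g) h) \<in> carrier mu2" if "U \<in> rcosets H" for U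
    using that assms TH.C2D[OF f] by (simp add: transfer_H[OF s_transversal] act_in)
  then show ?thesis
    unfolding cor_cochain_apply[OF s_transversal assms(2,3)]
    using H_neq by (simp add: rcosets_eq)
qed

text \<open>On the stabiliser of \<open>U\<close> the twisted rule \<open>transfer_mult\<close>
  becomes multiplicativity, so transfer elements commute with taking powers.\<close>

lemma transfer_pow:
  assumes U: "U \<in> rcosets H" and g: "g \<in> carrier G" and stab: "U #> g = U"
  shows "U #> (g [^] (j::nat)) = U"
    and "transfer_elt G s U (g [^] j) = transfer_elt G s U g [^] j"
proof -
  have *: "U #> (g [^] j) = U \<and> transfer_elt G s U (g [^] j) = transfer_elt G s U g [^] j"
  proof (induction j)
    case 0
    have "s U \<in> carrier G" using trans_carrier[OF s_transversal U] .
    then show ?case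
      using rcosets_sub[OF U] by (simp add: coset_mult_one transfer_elt_def)
  next
    case (Suc j)
    then show ?case
      using U g stab act_mult[OF U, of "g [^] j" g] transfer_mult[OF s_transversal U, of "g [^] j" g]
      by simp
  qed
  then show "U #> (g [^] j) = U" "transfer_elt G s U (g [^] j) = transfer_elt G s U g [^] j"
    by auto
qed

lemma power_cocycle_cor_inside:
  assumes f: "f \<in> Z2 (G\<lparr>carrier := H\<rparr>) mu2" and g: "g \<in> H"
  shows "power_cocycle G (cor_cochain G H mu2 s f) g l =
    power_cocycle (G\<lparr>carrier := H\<rparr>) f g l * power_cocycle (G\<lparr>carrier := H\<rparr>) f (t \<otimes> g \<otimes> inv t) l"
proof -
  have gG: "g \<in> carrier G" using H_carrier[OF g] .
  have tr: "transfer_elt G s H g = g" "transfer_elt G s (H #> t) g = t \<otimes> g \<otimes> inv t"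
    using gG by (simp_all add: transfer_elt_def act_H[OF g] act_coset[OF g])
  have "cor_cochain G H mu2 s f (g [^] j, g) =
      f (g [^] j, g) * f ((t \<otimes> g \<otimes> inv t) [^] j, t \<otimes> g \<otimes> inv t)" for j :: nat
    using transfer_pow[OF H_rcoset gG act_H[OF g]] transfer_pow[OF t_rcoset gG act_coset[OF g]]
      cor_apply[OF TH.Z2_C2[OF f], of "g [^] j" g] gG by (simp add: tr)
  then show ?thesis
    by (simp add: power_cocycle_def prod.distrib nat_pow_consistent[symmetric])
qed

text \<open>The factors at \<open>t [^] (2 * l)\<close> and \<open>t [^] (2 * l + 1)\<close> are
  paired. Both contain \<open>f (?q, t \<otimes> t)\<close>, and what remains of each is
  \<open>f (\<one>, \<one>)\<close>, so their product is a square of signs.\<close>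

lemma power_cocycle_cor_outside:
  assumes f: "f \<in> Z2 (G\<lparr>carrier := H\<rparr>) mu2"
  shows "power_cocycle G (cor_cochain G H mu2 s f) t (2 * l) = 1"
proof (induction l)
  case (Suc l)
  let ?c = "cor_cochain G H mu2 s f" and ?q = "(t \<otimes> t) [^] l"
  note t = t_carrier
  note fC = TH.Z2_C2[OF f]
  have ttH: "t \<otimes> t \<in> H"
    using act_swap t_mem by (force simp: r_coset_def)
  have tt: "t \<otimes> t \<in> carrier G" using t by simp
  have qH: "?q \<in> H"
    using TH.nat_pow_closed[of "t \<otimes> t" l] ttH by (simp add: nat_pow_consistent[symmetric])
  have tr: "transfer_elt G s H t = \<one>" "transfer_elt G s (H #> t) t = t \<otimes> t"
    using t by (simp_all add: transfer_elt_def act_swap)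
  \<comment> \<open>\<open>?q\<close> lies in \<open>H\<close> and commutes with \<open>t\<close>,
    so both of its transfer elements are \<open>?q\<close> itself.\<close>
  have trq: "transfer_elt G s H ?q = ?q" "transfer_elt G s (H #> t) ?q = ?q"
    using transfer_pow[OF H_rcoset tt act_H[OF ttH]] transfer_pow[OF t_rcoset tt act_coset[OF ttH]]
      transfer_mult[OF s_transversal H_rcoset t t] transfer_mult[OF s_transversal t_rcoset t t] t
    by (simp_all add: tr act_swap)
  have trqt: "transfer_elt G s H (?q \<otimes> t) = ?q" "transfer_elt G s (H #> t) (?q \<otimes> t) = ?q \<otimes> (t \<otimes> t)"
    using transfer_mult[OF s_transversal H_rcoset _ t, of ?q]
      transfer_mult[OF s_transversal t_rcoset _ t, of ?q] t
    by (simp_all add: trq tr act_H[OF qH] act_coset[OF qH])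
  have act: "H #> (?q \<otimes> t) = H #> t" "H #> t #> (?q \<otimes> t) = H"
    using act_mult[OF H_rcoset _ t, of ?q, symmetric] act_mult[OF t_rcoset _ t, of ?q, symmetric] t
    by (simp_all only: act_H[OF qH] act_coset[OF qH] act_swap nat_pow_closed tt)
  have "?c (?q, t) = f (?q, \<one>) * f (?q, t \<otimes> t)"
    using cor_apply[OF fC, of ?q t] t by (simp add: trq tr act_H[OF qH] act_coset[OF qH])
  moreover have "?c (?q \<otimes> t, t) = f (?q, t \<otimes> t) * f (?q \<otimes> (t \<otimes> t), \<one>)"
    using cor_apply[OF fC, of "?q \<otimes> t" t] t by (simp add: trqt tr act)
  moreover have "f (?q, \<one>) = f (\<one>, \<one>)" "f (?q \<otimes> (t \<otimes> t), \<one>) = f (\<one>, \<one>)"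
    using TH.Z2_mu2_one[OF f] qH TH.m_closed[of ?q "t \<otimes> t"] ttH by auto
  moreover have "f (\<one>, \<one>) * f (\<one>, \<one>) = 1" "f (?q, t \<otimes> t) * f (?q, t \<otimes> t) = 1"
    using mu2_square[OF TH.Z2_mu2D[OF f]] qH ttH subgroup.one_closed[OF subgroup_H] by auto
  ultimately have "?c (?q, t) * ?c (?q \<otimes> t, t) = 1"
    by (simp add: mult_ac)
  moreover have "t [^] (2 * l) = ?q"
    using nat_pow_pow[OF t, of 2 l] t by (simp add: numeral_2_eq_2)
  ultimately show ?case
    using Suc by (simp add: mult.assoc)
qed simp

end

section \<open>Corestricted classes on an element whose order is half the group order\<close>

text \<open>By cardinality the cyclic group generated by \<open>g\<close> fills
  \<open>H\<close>.\<close>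

lemma (in group) elem_generated_by_pow:
  assumes "finite (carrier G)" and H: "subgroup H G" and g: "g \<in> H" and "card H = ord g"
    and x: "x \<in> H"
  obtains k :: nat where "x = g [^] k"
proof -
  have gG: "g \<in> carrier G" using subgroup.mem_carrier[OF H g] .
  have "generate G {g} \<subseteq> H" using generate_subgroup_incl[of "{g}" H] H g by blast
  moreover have "card (generate G {g}) = card H"
    using generate_pow_card[OF gG] assms(4) by simp
  moreover have "finite H" using finite_subset[OF subgroup.subset[OF H] assms(1)] .
  ultimately have "x \<in> generate G {g}" using x by (metis card_subset_eq)
  then show ?thesis
    using that generate_pow_on_finite_carrier[OF assms(1) gG] by auto
qed

text \<open>One representative with product 1 is enough, since
  \<open>power_cocycle_extension_class\<close> forces -1 on every factor set of the
  extension.\<close>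

lemma (in group) power_cocycle_corestriction:
  assumes fin: "finite (carrier G)" and H: "subgroup H G" and idx: "card (rcosets H) = 2"
    and g: "g \<in> carrier G" and ord: "order G = 2 * ord g" and ev: "even (ord g)"
    and cbar: "cbar \<in> carrier (H2 (G\<lparr>carrier := H\<rparr>) mu2)"
  shows "\<exists>c \<in> corestriction G H mu2 cbar. power_cocycle G c g (ord g) = 1"
proof -
  have finr: "finite (rcosets H)" using idx card.infinite by fastforce
  interpret trivial_module G mu2 by (rule trivial_module_mu2)
  interpret F: finite_index_subgroup G mu2 H
    by (intro finite_index_subgroup.intro finite_index_subgroup_axioms.intro trivial_module_mu2 H finr)
  have cardH: "card H = ord g"
    using lagrange[OF H] idx ord by simp
  have posm: "ord g > 0" using ord_ge_1[OF fin g] by simp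
  have "H \<noteq> carrier G" using cardH ord posm by (auto simp: order_def)
  then obtain t0 where t0: "t0 \<in> carrier G" "t0 \<notin> H" using subgroup.subset[OF H] by blast
  \<comment> \<open>If \<open>g\<close> swaps the cosets, it serves as the coset representative
    itself, and \<open>power_cocycle_cor_outside\<close> applies to its own powers.\<close>
  define t where "t = (if g \<in> H then t0 else g)"
  interpret I: index_two_subgroup G H t
    by (intro index_two_subgroup.intro index_two_subgroup_axioms.intro F.finite_index_subgroup_axioms)
      (use idx t0 g in \<open>auto simp: t_def\<close>)
  obtain f where f: "f \<in> Z2 (G\<lparr>carrier := H\<rparr>) mu2"
    and cb: "cbar = B2 (G\<lparr>carrier := H\<rparr>) mu2 #>\<^bsub>C2 (G\<lparr>carrier := H\<rparr>) mu2\<^esub> f"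
    using cbar unfolding F.TH.carrier_H2 by blast
  let ?c = "cor_cochain G H mu2 I.s f"
  have "?c \<in> corestriction G H mu2 cbar"
    unfolding cb F.corestriction_coset[OF f I.s_transversal]
    by (intro coset_self F.cor_cochain_C2[OF I.s_transversal] F.TH.Z2_C2 f)
  moreover have "power_cocycle G ?c g (ord g) = 1"
  proof (cases "g \<in> H")
    case False
    then show ?thesis
      using I.power_cocycle_cor_outside[OF f, of "ord g div 2"] ev by (simp add: t_def)
  next
    case True
    note tG = I.t_carrier
    have conj_pow: "(t \<otimes> g \<otimes> inv t) [^] j = t \<otimes> g [^] j \<otimes> inv t" for j :: nat
    proof (induction j)
      case (Suc j)
      then show ?case using tG g
        by (simp add: m_assoc) (simp add: m_assoc[symmetric])
    qed (use tG in simp)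
    have "t \<otimes> g \<otimes> inv t \<in> H"
    proof -
      have "t \<otimes> g \<in> H #> t"
        using I.act_coset[OF True] I.t_mem by (force simp: r_coset_def)
      then show ?thesis
        using subgroup.rcos_module_imp[OF H is_group tG] by blast
    qed
    then obtain k :: nat where k: "t \<otimes> g \<otimes> inv t = g [^] k"
      using elem_generated_by_pow[OF fin H True cardH] by blast
    \<comment> \<open>Conjugation preserves orders, whereas for even \<open>k\<close> the power
      \<open>g [^] k\<close> would already be killed by half of \<open>ord g\<close>.\<close>
    have "odd k"
    proof
      assume "even k"
      then have "k * (ord g div 2) = ord g * (k div 2)" using ev by (auto elim!: evenE)
      then have "(t \<otimes> g \<otimes> inv t) [^] (ord g div 2) = \<one>"
        unfolding k using g by (simp add: nat_pow_pow nat_pow_pow[symmetric])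
      then have "t \<otimes> g [^] (ord g div 2) \<otimes> inv t = \<one>" unfolding conj_pow .
      then have "t \<otimes> g [^] (ord g div 2) = t \<otimes> \<one>"
        using tG g by (metis inv_inv inv_equality inv_closed m_closed nat_pow_closed r_one)
      then have "g [^] (ord g div 2) = \<one>"
        using tG g by simp
      then have "ord g dvd ord g div 2" using pow_eq_id[OF g] by blast
      then show False using ev posm by (auto dest: dvd_imp_le elim!: evenE)
    qed
    let ?P = "power_cocycle (G\<lparr>carrier := H\<rparr>) f g (ord g)"
    have "power_cocycle (G\<lparr>carrier := H\<rparr>) f (g [^] k) (ord g) = ?P ^ k"
      using F.TH.power_cocycle_pow[OF f, of g "ord g" k] True pow_ord_eq_1[OF g] ev
      by (simp add: nat_pow_consistent[symmetric])
    then have "power_cocycle G ?c g (ord g) = ?P * ?P ^ k"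
      unfolding I.power_cocycle_cor_inside[OF f True] k by simp
    moreover have "?P \<in> carrier mu2"
      using F.TH.power_cocycle_mem[OF F.TH.Z2_C2[OF f]] True by simp
    \<comment> \<open>The product is \<open>?P\<close> to the power \<open>1 + k\<close>, an even
      power of a sign.\<close>
    ultimately show ?thesis using \<open>odd k\<close> by (auto simp: mu2_mem)
  qed
  ultimately show ?thesis by blast
qed

section \<open>Extensions by the group of signs\<close>

locale mu2_extension =
  fixes i :: "int \<Rightarrow> 'e" and E :: "('e, 'l) monoid_scheme" (structure)
    and p :: "'e \<Rightarrow> 'g" and G :: "('g, 'm) monoid_scheme"
  assumes ext: "group_extension mu2 i E p G"

sublocale mu2_extension \<subseteq> E: group E
  using ext by (simp add: group_extension_def)

sublocale mu2_extension \<subseteq> p: group_hom E G p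
  using ext by (auto simp: group_extension_def group_hom_def group_hom_axioms_def epi_def)

sublocale mu2_extension \<subseteq> i: group_hom mu2 E i
  using ext by (auto simp: group_extension_def group_hom_def group_hom_axioms_def mon_def)

context mu2_extension
begin

lemma i_1: "i 1 = \<one>"
  using i.hom_one by (simp add: mu2_def)

lemma kernel_eq: "kernel E G p = {\<one>, i (-1)}"
  using ext i_1 by (auto simp: group_extension_def mu2_def)

lemma z_closed [simp]: "i (-1) \<in> carrier E"
  using i.hom_closed[of "-1"] by (simp add: mu2_mem)

lemma p_z: "p (i (-1)) = \<one>\<^bsub>G\<^esub>"
  using kernel_eq by (auto simp: kernel_def)

lemma z_neq: "i (-1) \<noteq> \<one>"
proof -
  have "inj_on i (carrier mu2)" using ext by (simp add: group_extension_def mon_def)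
  from inj_onD[OF this, of "-1" 1] show ?thesis by (auto simp: i_1 mu2_mem)
qed

lemma z_square: "i (-1) \<otimes> i (-1) = \<one>"
  using i.hom_mult[of "-1" "-1"] by (simp add: mu2_mem i_1)

text \<open>A conjugate of the only nontrivial kernel element is again a nontrivial kernel
  element.\<close>

lemma z_central:
  assumes e: "e \<in> carrier E" shows "i (-1) \<otimes> e = e \<otimes> i (-1)"
proof -
  have "e \<otimes> i (-1) \<otimes> inv e \<in> kernel E G p" using e by (simp add: kernel_def p_z)
  moreover have "e \<otimes> i (-1) \<otimes> inv e \<noteq> \<one>"
  proof
    assume "e \<otimes> i (-1) \<otimes> inv e = \<one>"
    then have "e \<otimes> i (-1) \<otimes> inv e \<otimes> e = e" using e by simp
    then show False using e z_neq by (simp add: E.m_assoc)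
  qed
  ultimately have "e \<otimes> i (-1) \<otimes> inv e = i (-1)" using kernel_eq by blast
  then show ?thesis
    using e by (metis E.inv_solve_right' E.m_closed z_closed)
qed

lemma fibre:
  assumes "x \<in> carrier E" "y \<in> carrier E" "p x = p y"
  shows "x = y \<or> x = i (-1) \<otimes> y"
proof -
  have "x \<otimes> inv y \<in> kernel E G p" using assms by (simp add: kernel_def)
  then have "x \<otimes> inv y = \<one> \<or> x \<otimes> inv y = i (-1)" using kernel_eq by blast
  then show ?thesis
    using assms by (metis E.inv_solve_right' E.l_one E.one_closed z_closed)
qed

text \<open>Both lifts of \<open>p x\<close> have \<open>m\<close>-th power \<open>i (-1)\<close>,
  so the power of the section value at \<open>p x\<close> does not depend on the section; the factor
  set records this power as a product.\<close>

lemma power_cocycle_extension_class: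
  assumes f: "f \<in> extension_class mu2 i E p G" and x: "x \<in> carrier E"
    and xm: "x [^] (m::nat) = i (-1)" and m: "even m"
  shows "power_cocycle G f (p x) m = -1"
proof -
  obtain s where fC: "f \<in> carrier (C2 G mu2)" and s: "s \<in> carrier G \<rightarrow> carrier E"
    and ps: "\<And>g. g \<in> carrier G \<Longrightarrow> p (s g) = g"
    and sf: "\<And>g h. g \<in> carrier G \<Longrightarrow> h \<in> carrier G \<Longrightarrow> s g \<otimes> s h = i (f (g, h)) \<otimes> s (g \<otimes>\<^bsub>G\<^esub> h)"
    using f unfolding extension_class_def by blast
  have sC: "s g \<in> carrier E" if "g \<in> carrier G" for g using s that by blast
  let ?g = "p x"
  have g: "?g \<in> carrier G" using x by simp
  note P = p.power_cocycle_mem[OF fC g]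
  have pw: "s \<one>\<^bsub>G\<^esub> \<otimes> s ?g [^] l = i (power_cocycle G f ?g l) \<otimes> s (?g [^]\<^bsub>G\<^esub> l)" for l :: nat
  proof (induction l)
    case (Suc l)
    let ?y = "?g [^]\<^bsub>G\<^esub> l"
    have y: "?y \<in> carrier G" using g by simp
    have fy: "f (?y, ?g) \<in> carrier mu2"
      using trivial_module.C2D[OF p.H.trivial_module_mu2 fC y g] .
    have "s \<one>\<^bsub>G\<^esub> \<otimes> s ?g [^] Suc l = i (power_cocycle G f ?g l) \<otimes> (s ?y \<otimes> s ?g)"
      using Suc sC g y P[of l] by (simp add: E.m_assoc[symmetric])
    also have "\<dots> = i (power_cocycle G f ?g (Suc l)) \<otimes> s (?g [^]\<^bsub>G\<^esub> Suc l)"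
      using sf[OF y g] i.hom_mult[OF P[of l] fy] sC g y P[of l] fy by (simp add: E.m_assoc)
    finally show ?case .
  qed (use sC in \<open>simp add: i_1\<close>)
  \<comment> \<open>The other lift differs by the central involution \<open>i (-1)\<close>, whose
    \<open>m\<close>-th power vanishes for even \<open>m\<close>.\<close>
  have "s ?g = x \<or> s ?g = i (-1) \<otimes> x"
    using fibre[OF sC[OF g] x] ps[OF g] by simp
  then have "s ?g [^] m = i (-1)"
  proof
    assume "s ?g = i (-1) \<otimes> x"
    then have "s ?g [^] m = i (-1) [^] m \<otimes> x [^] m"
      using E.pow_mult_distrib[OF z_central[OF x]] x by simp
    moreover have "i (-1) [^] m = \<one>"
    proof -
      obtain l where "m = 2 * l" using m by blast
      then show ?thesis
        using E.nat_pow_pow[OF z_closed, of 2 l] z_square by (simp add: numeral_2_eq_2)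
    qed
    ultimately show ?thesis using xm by simp
  qed (use xm in simp)
  moreover have "?g [^]\<^bsub>G\<^esub> m = \<one>\<^bsub>G\<^esub>"
    using p.hom_nat_pow[OF x, of m] xm by (simp add: p_z)
  ultimately have "s \<one>\<^bsub>G\<^esub> \<otimes> i (-1) = i (power_cocycle G f ?g m) \<otimes> s \<one>\<^bsub>G\<^esub>"
    using pw[of m] by simp
  then have "i (-1) \<otimes> s \<one>\<^bsub>G\<^esub> = i (power_cocycle G f ?g m) \<otimes> s \<one>\<^bsub>G\<^esub>"
    using z_central sC by simp
  then have "i (-1) = i (power_cocycle G f ?g m)"
    using sC P[of m] by simp
  then show ?thesis using P[of m] z_neq by (auto simp: mu2_mem i_1)
qed

text \<open>Otherwise \<open>E\<close> would be the direct product of \<open>C\<close> and the central subgroup of order 2.\<close>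

lemma z_in_index_two_abelian:
  assumes fin: "finite (carrier E)" and nc: "\<not> comm_group E" and C: "subgroup C E"
    and comm: "\<And>x y. x \<in> C \<Longrightarrow> y \<in> C \<Longrightarrow> x \<otimes> y = y \<otimes> x" and idx: "order E = 2 * card C"
  shows "i (-1) \<in> C"
proof (rule ccontr)
  assume nz: "i (-1) \<notin> C"
  let ?z = "i (-1)" and ?D = "(\<lambda>x. i (-1) \<otimes> x) ` C"
  have CE: "x \<in> carrier E" if "x \<in> C" for x using subgroup.mem_carrier[OF C that] .
  have finC: "finite C" using finite_subset[OF subgroup.subset[OF C] fin] .
  have "C \<inter> ?D = {}"
  proof -
    have False if "x \<in> C" "?z \<otimes> x \<in> C" for x
    proof -
      have "?z \<otimes> x \<otimes> inv x \<in> C"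
        using that C by (simp add: subgroup.m_closed subgroup.m_inv_closed)
      then show False using nz CE[OF that(1)] by (simp add: E.m_assoc)
    qed
    then show ?thesis by blast
  qed
  moreover have "card ?D = card C"
    by (rule card_image) (auto simp: inj_on_def CE)
  ultimately have "card (C \<union> ?D) = card (carrier E)"
    using idx finC by (simp add: card_Un_disjoint order_def)
  moreover have "C \<union> ?D \<subseteq> carrier E" using CE by auto
  ultimately have cover: "carrier E = C \<union> ?D"
    using card_subset_eq[OF fin] by blast
  have zc: "x \<otimes> (?z \<otimes> y) = ?z \<otimes> (x \<otimes> y)" if "x \<in> carrier E" "y \<in> carrier E" for x y
    using that z_central[OF that(1)] by (simp add: E.m_assoc[symmetric])
  \<comment> \<open>Elements of \<open>C\<close> commute with each other and \<open>i (-1)\<close>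
    is central; the mixed products and those within \<open>?D\<close> remain to be checked.\<close>
  have one_z: "?z \<otimes> x \<otimes> y = y \<otimes> (?z \<otimes> x)" if "x \<in> C" "y \<in> C" for x y
    using zc[of y x] comm[OF that] that by (simp add: CE E.m_assoc)
  have two_z: "?z \<otimes> x \<otimes> (?z \<otimes> y) = ?z \<otimes> y \<otimes> (?z \<otimes> x)" if "x \<in> C" "y \<in> C" for x y
    using zc[of x y] zc[of y x] comm[OF that] that by (simp add: CE E.m_assoc)
  have "x \<otimes> y = y \<otimes> x" if "x \<in> carrier E" "y \<in> carrier E" for x y
    using that comm one_z two_z unfolding cover by (elim UnE imageE) metis+
  then show False using nc E.group_comm_groupI by blast
qed

end

section \<open>The cyclic subgroup of index 2 and the conclusion\<close>

text \<open>The library describes cyclic groups by integer powers; finiteness allows natural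
  exponents, as \<open>power_cocycle\<close> uses.\<close>

lemma cyclic_subgroup_generator:
  assumes "group G" and C: "subgroup C G" and cyc: "cyclic_group (G\<lparr>carrier := C\<rparr>)"
    and fin: "finite (carrier G)"
  obtains \<sigma> where "\<sigma> \<in> C" "group.ord G \<sigma> = card C" "C = {\<sigma> [^]\<^bsub>G\<^esub> k | k. k \<in> (UNIV :: nat set)}"
proof -
  interpret group G by fact
  interpret S: group "G\<lparr>carrier := C\<rparr>" by (rule subgroup_imp_group[OF C])
  obtain x where x: "x \<in> C" and car: "C = range (\<lambda>k::int. x [^]\<^bsub>G\<lparr>carrier := C\<rparr>\<^esub> k)"
    using cyc unfolding S.cyclic_group by auto
  have xG: "x \<in> carrier G" using subgroup.mem_carrier[OF C x] .
  have "C = range (\<lambda>k::int. x [^]\<^bsub>G\<^esub> k)"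
    using car int_pow_consistent[OF C x] by simp
  then have gen: "C = generate G {x}" using generate_pow[OF xG] by auto
  then have "ord x = card C" using generate_pow_card[OF xG] by simp
  moreover have "C = {x [^]\<^bsub>G\<^esub> k | k. k \<in> (UNIV :: nat set)}"
    using gen generate_pow_on_finite_carrier[OF fin xG] by simp
  ultimately show ?thesis using that x by blast
qed

theorem proposition4p5:
  fixes n :: nat
    and G1 :: "('e, 'l) monoid_scheme"
    and G :: "('g, 'm) monoid_scheme"
    and i :: "int \<Rightarrow> 'e" and p :: "'e \<Rightarrow> 'g"
  assumes "n > 3"
    and "group G1" and "\<not> comm_group G1" and "order G1 = 2 ^ n"
    and "\<exists>C. subgroup C G1 \<and> cyclic_group (G1\<lparr>carrier := C\<rparr>) \<and> card C = 2 ^ (n - 1)"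
    and "group_extension mu2 i G1 p G"
  shows "\<not> (\<exists>H cbar. subgroup H G \<and> card (rcosets\<^bsub>G\<^esub> H) = 2 \<and>
      cbar \<in> carrier (H2 (G\<lparr>carrier := H\<rparr>) mu2) \<and>
      extension_class mu2 i G1 p G = corestriction G H mu2 cbar)"
proof clarify
  fix H cbar
  assume H: "subgroup H G" "card (rcosets\<^bsub>G\<^esub> H) = 2"
    and cbar: "cbar \<in> carrier (H2 (G\<lparr>carrier := H\<rparr>) mu2)"
    and eq: "extension_class mu2 i G1 p G = corestriction G H mu2 cbar"
  interpret X: mu2_extension i G1 p G by unfold_locales (fact assms(6))
  define m :: nat where "m = 2 ^ (n - 2)"
  have pow: "2 ^ (n - 1) = 2 * m" "2 ^ n = 4 * m" "m > 0" "even m"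
  proof -
    obtain j where "n = 3 + j" using \<open>n > 3\<close> less_imp_add_positive by blast
    then show "2 ^ (n - 1) = 2 * m" "2 ^ n = 4 * m" "m > 0" "even m"
      by (simp_all add: m_def power_add)
  qed
  \<comment> \<open>The \<open>order\<close> of an infinite carrier is 0, so a power of 2 forces
    finiteness.\<close>
  have fin: "finite (carrier G1)"
    using assms(4) by (metis card.infinite order_def power_eq_0_iff zero_neq_numeral)
  obtain C where C: "subgroup C G1" "cyclic_group (G1\<lparr>carrier := C\<rparr>)" "card C = 2 * m"
    using assms(5) pow(1) by auto
  obtain \<sigma> where \<sigma>: "\<sigma> \<in> C" and "X.E.ord \<sigma> = card C"
    and C_eq: "C = {\<sigma> [^]\<^bsub>G1\<^esub> k | k. k \<in> (UNIV :: nat set)}"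
    by (rule cyclic_subgroup_generator[OF assms(2) C(1,2) fin])
  then have ord: "X.E.ord \<sigma> = 2 * m" using C(3) by simp
  have \<sigma>G: "\<sigma> \<in> carrier G1" using subgroup.mem_carrier[OF C(1) \<sigma>] .
  \<comment> \<open>This is where non-commutativity of \<open>G1\<close> enters.\<close>
  have "i (-1) \<in> C"
  proof (rule X.z_in_index_two_abelian[OF fin assms(3) C(1)])
    show "x \<otimes>\<^bsub>G1\<^esub> y = y \<otimes>\<^bsub>G1\<^esub> x" if "x \<in> C" "y \<in> C" for x y
      using that \<sigma>G unfolding C_eq by (auto simp: X.E.nat_pow_mult add.commute)
  qed (use C(3) assms(4) pow(2) in simp)
  then obtain k :: nat where k: "i (-1) = \<sigma> [^]\<^bsub>G1\<^esub> k" unfolding C_eq by blast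
  \<comment> \<open>A cyclic group of order \<open>2 * m\<close> has only one involution:
    \<open>k\<close> is a multiple of \<open>m\<close> since \<open>i (-1)\<close> squares to
    \<one>, and an odd multiple since \<open>i (-1)\<close> is not \<one>.\<close>
  have "\<sigma> [^]\<^bsub>G1\<^esub> (2 * k) = \<one>\<^bsub>G1\<^esub>"
    using X.z_square k \<sigma>G by (simp add: X.E.nat_pow_mult mult_2)
  then have "m dvd k" using X.E.pow_eq_id[OF \<sigma>G] ord by simp
  then obtain q where q: "k = m * q" by blast
  have "\<sigma> [^]\<^bsub>G1\<^esub> (2 * m) = \<one>\<^bsub>G1\<^esub>" using X.E.pow_eq_id[OF \<sigma>G, of "2 * m"] ord by simp
  then have per: "\<sigma> [^]\<^bsub>G1\<^esub> (2 * m * l) = \<one>\<^bsub>G1\<^esub>" for l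
    using X.E.nat_pow_pow[OF \<sigma>G, of "2 * m" l] by simp
  have "odd q"
  proof
    assume "even q"
    then show False using per[of "q div 2"] k q X.z_neq by (auto elim!: evenE simp: mult_ac)
  qed
  then obtain l where "q = 2 * l + 1" by (elim oddE)
  then have "k = 2 * m * l + m" using q by (simp add: algebra_simps)
  then have \<sigma>m: "\<sigma> [^]\<^bsub>G1\<^esub> m = i (-1)"
    using k per[of l] \<sigma>G by (simp add: X.E.nat_pow_mult[symmetric])
  let ?g = "p \<sigma>"
  have g: "?g \<in> carrier G" using \<sigma>G by simp
  have surj: "p ` carrier G1 = carrier G"
    using assms(6) by (simp add: group_extension_def epi_def)
  have finG: "finite (carrier G)" using fin surj by (metis finite_imageI)
  have "X.p.H.ord ?g = m"
  proof (rule dvd_antisym)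
    have "?g [^]\<^bsub>G\<^esub> m = \<one>\<^bsub>G\<^esub>"
      using X.p.hom_nat_pow[OF \<sigma>G, of m] \<sigma>m by (simp add: X.p_z)
    then show "X.p.H.ord ?g dvd m" using X.p.H.pow_eq_id[OF g] by blast
    let ?o = "X.p.H.ord ?g"
    \<comment> \<open>A relation for \<open>?g\<close> lifts to \<sigma> up to the kernel, so
      doubling the exponent kills \<sigma>, whose order is \<open>2 * m\<close>.\<close>
    have "p (\<sigma> [^]\<^bsub>G1\<^esub> ?o) = p \<one>\<^bsub>G1\<^esub>"
      using X.p.hom_nat_pow[OF \<sigma>G, of ?o] X.p.H.pow_ord_eq_1[OF g] by simp
    then have "\<sigma> [^]\<^bsub>G1\<^esub> ?o = \<one>\<^bsub>G1\<^esub> \<or> \<sigma> [^]\<^bsub>G1\<^esub> ?o = i (-1)"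
      using X.fibre[of "\<sigma> [^]\<^bsub>G1\<^esub> ?o" "\<one>\<^bsub>G1\<^esub>"] \<sigma>G by simp
    then have "\<sigma> [^]\<^bsub>G1\<^esub> ?o \<otimes>\<^bsub>G1\<^esub> \<sigma> [^]\<^bsub>G1\<^esub> ?o = \<one>\<^bsub>G1\<^esub>" using X.z_square by auto
    then have "\<sigma> [^]\<^bsub>G1\<^esub> (2 * ?o) = \<one>\<^bsub>G1\<^esub>"
      using \<sigma>G by (simp add: X.E.nat_pow_mult mult_2)
    then show "m dvd ?o" using X.E.pow_eq_id[OF \<sigma>G] ord by simp
  qed
  moreover have "order G = 2 * m"
  proof -
    have K: "kernel G1 G p = {\<one>\<^bsub>G1\<^esub>, i (-1)}" by (rule X.kernel_eq)
    have "card (rcosets\<^bsub>G1\<^esub> kernel G1 G p) = order G"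
      using iso_same_card[OF X.p.FactGroup_iso_set[OF surj, THEN is_isoI]]
      by (simp add: FactGroup_def order_def)
    then show ?thesis
      using X.E.lagrange[OF X.p.subgroup_kernel] K X.z_neq assms(4) pow(2) by simp
  qed
  ultimately obtain c where "c \<in> corestriction G H mu2 cbar" "power_cocycle G c ?g m = 1"
    using X.p.H.power_cocycle_corestriction[OF finG H g _ _ cbar] pow(4) by auto
  \<comment> \<open>As the two classes are equal, \<open>c\<close> is also a factor set of the
    extension, so its product along \<open>?g\<close> would be both 1 and -1.\<close>
  then show False
    using X.power_cocycle_extension_class[OF _ \<sigma>G \<sigma>m pow(4)] eq by force
qed

end
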